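(* Let $k\ge2$ be real and let $N\ge1$. Let $Q_0,\dots,Q_N$ be objects each of which is a dyadic segment, a good dyadic square, or $\{\infty\}$, with vertices $q_{i,1},\dots,q_{i,4}$ (listed with repetition if there are fewer than 4). For every choice of $z_i\in\langle Q_i\rangle$, $i=0,\dots,N$, $$\sum_{0\le a<b\le N}G_k(z_a,z_b)\;\ge\;\sum_{I}\lambda_{i_0}(z_0)\cdots\lambda_{i_N}(z_N)\,\mathcal{E}(I)-\sum_{i=0}^N\sum_{j\ne i}\epsilon(Q_i,Q_j),$$ where the first sum on the right is over all multi-indices $I=(i_0,\dots,i_N)\in\{1,2,3,4\}^{N+1}$ and $\mathcal{E}(I)=\sum_{0\le a<b\le N}G_k(q_{a,i_a},q_{b,i_b})$.
   Context: Stereographic projection $\Sigma(x,y,z)=(x/(1-z),y/(1-z))$, $\Sigma(0,0,1)=\infty$; $\widehat p=\Sigma^{-1}(p)$, $\widehat\infty=(0,0,1)$. $G_k(p,q)=(4-\|\widehat p-\widehat q\|^2)^k$. Dyadic segments: segments of the $x$-axis of $\mathbb{R}^2$ obtained from $[0,4]\times\{0\}$ by repeated bisection. Dyadic squares: obtained from $[-2,2]^2$ by repeated quartering; good if contained in $[-3/2,3/2]^2$ with side length $\le1/2$. $Q$ also denotes its vertex set, $\langle Q\rangle$ its convex hull, $\widehat Q=\Sigma^{-1}(Q)$, $\langle\widehat Q\rangle$ the convex hull of $\widehat Q$ in $\mathbb{R}^3$, $\widehat{\langle Q\rangle}=\Sigma^{-1}(\langle Q\rangle)$; for $Q=\{\infty\}$,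 $\langle Q\rangle=Q$. Stereographic weighting system: for each such $Q$ and each $z\in\langle Q\rangle$, a point $z^*\in\langle\widehat Q\rangle$ closest to $\widehat z$ and numbers $\lambda_i(z)\ge0$ with $\sum_{i=1}^4\lambda_i(z)=1$ and $z^*=\sum_i\lambda_i(z)\widehat q_i$ are fixed once and for all. $d(Q)$ = diameter of $\langle\widehat Q\rangle$; $d_1(Q)$ = longest edge length of $\langle\widehat Q\rangle$; $D_Q$ = smallest closed disk in $\mathbb{R}^2$ whose boundary contains $Q$, $d_2(Q)$ = Euclidean diameter of $\Sigma^{-1}(D_Q)$. $\chi(D,d)=\frac{d^2}{4D}+\frac{d^4}{2D^3}$; $\delta(Q)=\chi(2,d_2)$ for segments, $\max(\chi(1,d_1),\chi(2,d_2))$ for good squares; $d(\{\infty\})=\delta(\{\infty\})=0$. $(Q\cdot Q')_{\max}=\max_{i,j}\widehat q_i\cdot\widehat q'_j+\delta(Q)+\delta(Q')+\delta(Q)\delta(Q')$ for $Q,Q'\ne\{\infty\}$; $(Q\cdot\{\infty\})_{\max}=\max_i\widehat q_i\cdot(0,0,1)$. $T=2+2(Q\cdot Q')_{\max}$; $\epsilon(Q,Q')=\frac12k(k-1)T^{k-2}d(Q)^2+2kT^{k-1}\delta(Q)$, and $\epsilon(\{\infty\},Q')=0$. *)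

theory Defs
  imports "HOL-Analysis.Analysis"
begin

datatype ept = Fin "real \<times> real" | Infty

text \<open>Inverse stereographic projection onto the unit sphere in R^3
  (inverse of Sigma(x,y,z) = (x/(1-z), y/(1-z))), with infinity going to (0,0,1).\<close>
fun invs :: "ept \<Rightarrow> real \<times> real \<times> real" where
  "invs Infty = (0, 0, 1)"
| "invs (Fin (u, v)) =
     (2 * u / (1 + u\<^sup>2 + v\<^sup>2), 2 * v / (1 + u\<^sup>2 + v\<^sup>2), (u\<^sup>2 + v\<^sup>2 - 1) / (u\<^sup>2 + v\<^sup>2 + 1))"

definition invsR :: "real \<times> real \<Rightarrow> real \<times> real \<times> real" where
  "invsR p = invs (Fin p)"

definition Gk :: "real \<Rightarrow> ept \<Rightarrow> ept \<Rightarrow> real" where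
  "Gk k p q = (4 - (norm (invs p - invs q))\<^sup>2) powr k"

text \<open>Objects: dyadic segment (level n, index j): [4j/2^n, 4(j+1)/2^n] x {0};
  dyadic square (level n, indices i j): [-2+s i, -2+s(i+1)] x [-2+s j, -2+s(j+1)], s = 4/2^n;
  and the point at infinity.\<close>
datatype obj = DSeg nat nat | DSq nat nat nat | DInf

definition side :: "nat \<Rightarrow> real" where
  "side n = 4 / 2 ^ n"

fun vertsR :: "obj \<Rightarrow> nat \<Rightarrow> real \<times> real" where
  "vertsR (DSeg n j) i =
     (if i = 1 \<or> i = 3 then (side n * j, 0) else (side n * (j + 1), 0))"
| "vertsR (DSq n a b) i =
     (let x0 = -2 + side n * a; y0 = -2 + side n * b; s = side n in
      if i = 1 then (x0, y0) else if i = 2 then (x0 + s, y0)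
      else if i = 3 then (x0 + s, y0 + s) else (x0, y0 + s))"
| "vertsR DInf i = (0, 0)"

definition verts :: "obj \<Rightarrow> nat \<Rightarrow> ept" where
  "verts Q i = (if Q = DInf then Infty else Fin (vertsR Q i))"

definition valid_obj :: "obj \<Rightarrow> bool" where
  "valid_obj Q = (case Q of
      DSeg n j \<Rightarrow> j < 2 ^ n
    | DSq n a b \<Rightarrow> a < 2 ^ n \<and> b < 2 ^ n \<and> side n \<le> 1/2
        \<and> -3/2 \<le> -2 + side n * a \<and> -2 + side n * (a + 1) \<le> 3/2
        \<and> -3/2 \<le> -2 + side n * b \<and> -2 + side n * (b + 1) \<le> 3/2
    | DInf \<Rightarrow> True)"

definition vsetR :: "obj \<Rightarrow> (real \<times> real) set" where
  "vsetR Q = vertsR Q ` {1..4}"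

definition hullQ :: "obj \<Rightarrow> ept set" where
  "hullQ Q = (if Q = DInf then {Infty} else Fin ` (convex hull (vsetR Q)))"

definition hullQhat :: "obj \<Rightarrow> (real \<times> real \<times> real) set" where
  "hullQhat Q = convex hull ((\<lambda>i. invs (verts Q i)) ` {1..4})"

definition weighting_system :: "(obj \<Rightarrow> ept \<Rightarrow> nat \<Rightarrow> real) \<Rightarrow> bool" where
  "weighting_system lam =
     (\<forall>Q z. valid_obj Q \<longrightarrow> z \<in> hullQ Q \<longrightarrow>
        (\<forall>i\<in>{1..4}. 0 \<le> lam Q z i) \<and> (\<Sum>i=1..4. lam Q z i) = 1 \<and>
        (let zs = (\<Sum>i=1..4. lam Q z i *\<^sub>R invs (verts Q i)) in
           zs \<in> hullQhat Q \<and> (\<forall>w\<in>hullQhat Q. dist (invs z) zs \<le> dist (invs z) w)))"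

definition dQ :: "obj \<Rightarrow> real" where
  "dQ Q = (if Q = DInf then 0 else diameter (hullQhat Q))"

definition d1Q :: "obj \<Rightarrow> real" where
  "d1Q Q = Max {dist (invs (verts Q 1)) (invs (verts Q 2)), dist (invs (verts Q 2)) (invs (verts Q 3)),
                dist (invs (verts Q 3)) (invs (verts Q 4)), dist (invs (verts Q 4)) (invs (verts Q 1))}"

definition DQ :: "obj \<Rightarrow> (real \<times> real) set" where
  "DQ Q = (THE D. \<exists>c r. D = cball c r \<and> vsetR Q \<subseteq> sphere c r \<and>
              (\<forall>c' r'. vsetR Q \<subseteq> sphere c' r' \<longrightarrow> r \<le> r'))"

definition d2Q :: "obj \<Rightarrow> real" where
  "d2Q Q = diameter (invsR ` DQ Q)"

definition chi :: "real \<Rightarrow> real \<Rightarrow> real" where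
  "chi D d = d\<^sup>2 / (4 * D) + d ^ 4 / (2 * D ^ 3)"

definition deltaQ :: "obj \<Rightarrow> real" where
  "deltaQ Q = (case Q of
      DSeg _ _ \<Rightarrow> chi 2 (d2Q Q)
    | DSq _ _ _ \<Rightarrow> max (chi 1 (d1Q Q)) (chi 2 (d2Q Q))
    | DInf \<Rightarrow> 0)"

definition dotmax :: "obj \<Rightarrow> obj \<Rightarrow> real" where
  "dotmax Q Q' =
     (if Q' = DInf then Max ((\<lambda>i. invs (verts Q i) \<bullet> (0, 0, 1)) ` {1..4})
      else Max ((\<lambda>(i, j). invs (verts Q i) \<bullet> invs (verts Q' j)) ` ({1..4} \<times> {1..4}))
           + deltaQ Q + deltaQ Q' + deltaQ Q * deltaQ Q')"

definition epsQ :: "real \<Rightarrow> obj \<Rightarrow> obj \<Rightarrow> real" where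
  "epsQ k Q Q' =
     (if Q = DInf then 0
      else (let T = 2 + 2 * dotmax Q Q' in
            1/2 * k * (k - 1) * T powr (k - 2) * (dQ Q)\<^sup>2 + 2 * k * T powr (k - 1) * deltaQ Q))"

definition energyI :: "real \<Rightarrow> nat \<Rightarrow> (nat \<Rightarrow> obj) \<Rightarrow> (nat \<Rightarrow> nat) \<Rightarrow> real" where
  "energyI k N Qs I = (\<Sum>a\<in>{0..N}. \<Sum>b\<in>{a<..N}. Gk k (verts (Qs a) (I a)) (verts (Qs b) (I b)))"

end

theory Submission
  imports Defs
begin

text \<open>
  Since \<open>4 - |p - q|\<^sup>2 = 2 + 2 p \<bullet> q\<close> on the unit sphere, \<open>G\<^sub>k\<close> is \<open>t powr k\<close> evaluated at a function
  affine in each argument. Replacing one point by the weighted average over the vertices of its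
  object costs a second-order term (a weighted variance, at most \<open>d\<^sup>2\<close> in these units) plus a
  first-order term for the distance from the sphere point to the hull of the lifted vertices; doing
  this for both members of each pair gives the theorem.

  The geometric core is that this distance is at most \<open>\<delta>\<close>. If the ray from the centre of the sphere
  through the point meets the hull, the radial projection works, because the hull lies in the plane of
  the circle bounding the lifted disk; this gives \<open>\<chi> 2 d\<^sub>2\<close>. Otherwise the point lies between a
  great circle through two adjacent lifted vertices and the circle through them and the north pole.
  Every circle of the sphere in between has diameter at least 1, so the orthogonal projection to the
  edge works; this gives \<open>\<chi> 1 d\<^sub>1\<close>.
\<close>

section \<open>Projections to chords and planar sections of the sphere\<close>

text \<open>Project \<open>z\<close> orthogonally to the line through \<open>p\<close> and \<open>q\<close>. The perpendicular component is a
  nonnegative combination of those of the midpoint \<open>m\<close> and of \<open>m - n\<close>, so it suffices that both of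
  these directions have inner product at least \<open>r\<close> with \<open>m\<close>; the foot lies on the chord because
  its power with respect to the sphere is nonnegative.\<close>

lemma chord_projection:
  fixes p q z n :: "'a::real_inner"
  assumes "norm p = 1" "norm q = 1" "norm z = 1" "p \<noteq> q"
    and comb: "z + \<nu> *\<^sub>R n = A *\<^sub>R p + B *\<^sub>R q"
    and "0 \<le> \<nu>" "1 + \<nu> \<le> A + B"
    and "0 \<le> r" and r_le: "r \<le> norm (midpoint p q)"
    and n_dir: "r * norm (midpoint p q - n - (((midpoint p q - n) \<bullet> (q - p)) / (dist p q)\<^sup>2) *\<^sub>R (q - p))
      \<le> midpoint p q \<bullet> (midpoint p q - n)"
  shows "\<exists>w\<in>closed_segment p q. (dist z w)\<^sup>2 + 2 * r * dist z w \<le> (dist p q)\<^sup>2 / 4"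
proof -
  define d m e where "d = dist p q" and "m = midpoint p q" and "e = q - p"
  define proj where "proj v = v - ((v \<bullet> e) / d\<^sup>2) *\<^sub>R e" for v
  have d: "d > 0" using assms(4) by (simp add: d_def)
  have ee: "e \<bullet> e = d\<^sup>2"
    by (simp add: e_def d_def dist_norm power2_norm_eq_inner inner_commute algebra_simps)
  have pp: "p \<bullet> p = 1" "q \<bullet> q = 1" "z \<bullet> z = 1"
    using assms(1-3) by (simp_all add: dot_square_norm)
  have me: "m \<bullet> e = 0"
    using pp by (simp add: m_def e_def midpoint_def inner_simps inner_commute)
  have mm: "m \<bullet> m = 1 - d\<^sup>2 / 4"
    unfolding ee[symmetric] using pp by (simp add: m_def e_def midpoint_def inner_simps inner_commute field_simps)
  have pm: "p = m - (1/2) *\<^sub>R e" and qm: "q = m + (1/2) *\<^sub>R e"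
    by (simp_all add: m_def e_def midpoint_def algebra_simps flip: scaleR_add_left)
  have proj_lin: "proj (u + c *\<^sub>R v) = proj u + c *\<^sub>R proj v" for u v c
    by (simp add: proj_def inner_simps algebra_simps add_divide_distrib)
  have proj_e: "proj e = 0" using ee d by (simp add: proj_def)
  have proj_m: "proj m = m" by (simp add: proj_def me)
  have proj_inner: "m \<bullet> proj v = m \<bullet> v" for v by (simp add: proj_def inner_simps me)
  define g where "g = proj (z - m)"
  \<comment> \<open>The \<open>e\<close> part disappears under \<open>proj\<close>; the other two
    coefficients are nonnegative by hypothesis, so \<open>g\<close> is a nonnegative combination of
    \<open>proj (m - n)\<close> and \<open>m\<close>.\<close>
  have z_m: "z - m = \<nu> *\<^sub>R (m - n) + (A + B - 1 - \<nu>) *\<^sub>R m + ((B - A) / 2) *\<^sub>R e"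
  proof -
    have "z = A *\<^sub>R p + B *\<^sub>R q - \<nu> *\<^sub>R n" using comb by (simp add: algebra_simps)
    then show ?thesis unfolding pm qm by (simp add: algebra_simps diff_divide_distrib)
  qed
  have "proj (\<nu> *\<^sub>R (m - n)) = \<nu> *\<^sub>R proj (m - n)"
    using proj_lin[of 0 \<nu> "m - n"] by (simp add: proj_def)
  then have g: "g = \<nu> *\<^sub>R proj (m - n) + (A + B - 1 - \<nu>) *\<^sub>R m"
    unfolding g_def z_m by (simp add: proj_lin proj_e proj_m)
  have mg: "r * norm g \<le> m \<bullet> g"
  proof -
    have "norm g \<le> \<nu> * norm (proj (m - n)) + (A + B - 1 - \<nu>) * norm m"
      unfolding g using assms(6,7) by (intro order_trans[OF norm_triangle_ineq]) simp
    then have "r * norm g \<le> \<nu> * (r * norm (proj (m - n))) + (A + B - 1 - \<nu>) * (r * norm m)"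
      using mult_left_mono[OF _ \<open>0 \<le> r\<close>] by (fastforce simp: algebra_simps)
    also have "\<dots> \<le> \<nu> * (m \<bullet> (m - n)) + (A + B - 1 - \<nu>) * (m \<bullet> m)"
    proof (intro add_mono mult_left_mono)
      show "r * norm (proj (m - n)) \<le> m \<bullet> (m - n)"
        using n_dir by (simp add: proj_def m_def d_def e_def)
      show "r * norm m \<le> m \<bullet> m"
        using r_le by (simp add: m_def dot_square_norm power2_eq_square mult_right_mono)
    qed (use assms(6,7) in auto)
    also have "\<dots> = m \<bullet> g" unfolding g by (simp add: inner_add_right proj_inner)
    finally show ?thesis .
  qed
  define t where "t = ((z - m) \<bullet> e) / d\<^sup>2"
  define w where "w = m + t *\<^sub>R e"
  have zw: "z - w = g" by (simp add: w_def g_def proj_def t_def)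
  have ge: "g \<bullet> e = 0" using ee d by (simp add: g_def proj_def inner_simps)
  \<comment> \<open>Expanding the norm of \<open>z\<close> about \<open>m\<close> computes the power
    of the foot \<open>w\<close> with respect to the unit sphere in two ways: along the chord and
    along \<open>g\<close>.\<close>
  have "z = m + t *\<^sub>R e + g" by (simp add: zw[symmetric] w_def)
  then have "1 = (m + t *\<^sub>R e + g) \<bullet> (m + t *\<^sub>R e + g)" using pp by simp
  also have "\<dots> = m \<bullet> m + t\<^sup>2 * (e \<bullet> e) + g \<bullet> g + 2 * (m \<bullet> g)"
    using me ge by (simp add: inner_simps inner_commute power2_eq_square)
  finally have key: "(norm g)\<^sup>2 + 2 * (m \<bullet> g) = d\<^sup>2 * (1/4 - t\<^sup>2)"
    unfolding mm ee power2_norm_eq_inner by (simp add: algebra_simps)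
  have "0 \<le> m \<bullet> g" using mg \<open>0 \<le> r\<close> by (meson mult_nonneg_nonneg norm_ge_zero order_trans)
  then have "0 \<le> d\<^sup>2 * (1/4 - t\<^sup>2)" unfolding key[symmetric] by simp
  then have "t\<^sup>2 \<le> (1/2)\<^sup>2" using d by (simp add: zero_le_mult_iff power_divide)
  then have t: "\<bar>t\<bar> \<le> 1/2" by (simp add: abs_le_square_iff[symmetric])
  have "w = (1 - (t + 1/2)) *\<^sub>R p + (t + 1/2) *\<^sub>R q"
  proof -
    have "1 - (t + 1/2) = 1/2 - t" by simp
    then show ?thesis by (simp add: w_def m_def e_def midpoint_def algebra_simps)
  qed
  moreover have "0 \<le> t + 1/2" "t + 1/2 \<le> 1" using t by (simp_all add: abs_le_iff)
  ultimately have "w \<in> closed_segment p q" unfolding in_segment by blast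
  moreover have "(dist z w)\<^sup>2 + 2 * r * dist z w \<le> d\<^sup>2 / 4"
  proof -
    have "(dist z w)\<^sup>2 + 2 * r * dist z w \<le> d\<^sup>2 * (1/4 - t\<^sup>2)"
      using mg key by (simp add: dist_norm zw)
    also have "\<dots> \<le> d\<^sup>2 * (1/4)" by (intro mult_left_mono) auto
    finally show ?thesis by simp
  qed
  ultimately show ?thesis unfolding d_def by blast
qed

section \<open>Scalar inequalities for the error function, and the radial projection\<close>

lemma chi_mono: "0 < D \<Longrightarrow> 0 \<le> d \<Longrightarrow> d \<le> d' \<Longrightarrow> chi D d \<le> chi D d'"
  unfolding chi_def by (intro add_mono divide_right_mono power_mono) auto

lemma chi_nonneg: "0 < D \<Longrightarrow> 0 \<le> chi D d"
  unfolding chi_def by simp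

text \<open>For \<open>d \<le> 1\<close> the quadratic in \<open>h\<close> is increasing on the
  nonnegative reals, and at \<open>h = chi 1 d\<close> it has already reached
  \<open>d\<^sup>2 / 4\<close>. The excess there is a polynomial in \<open>x = d\<^sup>2\<close>,
  seen to be nonnegative by completing a square.\<close>

lemma le_chi_one:
  fixes h d :: real
  assumes "0 \<le> h" "0 \<le> d" "d \<le> 1" and h: "h\<^sup>2 + 2 * ((1 - d\<^sup>2) / 2) * h \<le> d\<^sup>2 / 4"
  shows "h \<le> chi 1 d"
proof (rule ccontr)
  define x where "x = d\<^sup>2"
  have x: "0 \<le> x" "x \<le> 1" using assms(2,3) by (auto simp: x_def power_le_one)
  define H where "H = x / 4 + x\<^sup>2 / 2"
  have H: "chi 1 d = H" by (simp add: chi_def H_def x_def)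
  assume "\<not> h \<le> chi 1 d"
  then have "H < h" using H by simp
  moreover have "0 \<le> H" using x by (simp add: H_def)
  ultimately have "H\<^sup>2 < h\<^sup>2" "(1 - x) * H \<le> (1 - x) * h"
    using x by (auto intro!: power_strict_mono mult_left_mono)
  moreover have "h\<^sup>2 + (1 - x) * h \<le> x / 4" using h by (simp add: x_def field_simps)
  ultimately have "H\<^sup>2 + (1 - x) * H < x / 4" by linarith
  moreover have "H\<^sup>2 + (1 - x) * H - x / 4 = (x\<^sup>2 / 16) * (5 - 4 * x + 4 * x\<^sup>2)"
    unfolding H_def by (simp add: power2_eq_square field_simps)
  moreover have "5 - 4 * x + 4 * x\<^sup>2 = 4 + (1 - 2 * x)\<^sup>2" by (simp add: power2_eq_square field_simps)
  ultimately show False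
    by (smt (verit) mult_nonneg_nonneg zero_le_power2 divide_nonneg_nonneg)
qed

text \<open>The hypothesis says \<open>y * (2 - y) \<le> s\<close> with
  \<open>s = d\<^sup>2 / 4\<close>. Now \<open>chi 2 d = s / 2 + s\<^sup>2\<close> is increasing in
  \<open>s\<close>, and at \<open>s = y * (2 - y)\<close> it is at least \<open>y\<close>.\<close>

lemma le_chi_two:
  fixes y d :: real
  assumes "0 \<le> y" "y \<le> 1" and "1 - d\<^sup>2 / 4 \<le> (1 - y)\<^sup>2"
  shows "y \<le> chi 2 d"
proof -
  define s where "s = d\<^sup>2 / 4"
  have s: "y * (2 - y) \<le> s" using assms(3) by (simp add: s_def power2_eq_square algebra_simps)
  have "0 \<le> y * (2 - y)" using assms by simp
  then have "(y * (2 - y))\<^sup>2 \<le> s\<^sup>2" using s by (intro power_mono)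
  then have "y * (2 - y) / 2 + (y * (2 - y))\<^sup>2 \<le> s / 2 + s\<^sup>2" using s by linarith
  moreover have "chi 2 d = s / 2 + s\<^sup>2" by (simp add: chi_def s_def power_divide)
  moreover have "y * (2 - y) / 2 + (y * (2 - y))\<^sup>2 - y = y\<^sup>2 * ((1 - y) * (3 - y) + 1 / 2)"
    by (simp add: power2_eq_square field_simps)
  moreover have "0 \<le> y\<^sup>2 * ((1 - y) * (3 - y) + 1 / 2)" using assms by simp
  ultimately show ?thesis by linarith
qed

text \<open>A unit vector that is a nonnegative combination of points of the unit ball has total
  weight \<open>L \<ge> 1\<close>, so \<open>z / L\<close> is a convex combination of them and lies
  in their common plane. Hypothesis \<open>b\<close> bounds the distance of that plane from the
  origin below by that of a plane cutting the sphere in a circle of diameter \<open>d\<close>, so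
  \<open>1 / L\<close> cannot be small, and the distance moved is \<open>1 - 1 / L\<close>.\<close>

lemma radial_projection:
  fixes v :: "nat \<Rightarrow> 'a::real_inner"
  assumes "finite S" and m: "\<And>i. i \<in> S \<Longrightarrow> 0 \<le> m i" and z: "z = (\<Sum>i\<in>S. m i *\<^sub>R v i)"
    and "norm z = 1" and v: "\<And>i. i \<in> S \<Longrightarrow> norm (v i) \<le> 1"
    and a: "\<And>i. i \<in> S \<Longrightarrow> v i \<bullet> a = b" and "a \<noteq> 0"
    and b: "(1 - d\<^sup>2 / 4) * (norm a)\<^sup>2 \<le> b\<^sup>2"
  shows "\<exists>w\<in>convex hull (v ` S). dist z w \<le> chi 2 d"
proof -
  define L where "L = sum m S"
  have "1 \<le> (\<Sum>i\<in>S. norm (m i *\<^sub>R v i))"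
    using norm_sum[of "\<lambda>i. m i *\<^sub>R v i" S] z \<open>norm z = 1\<close> by simp
  also have "\<dots> \<le> L" unfolding L_def
    using m v by (intro sum_mono) (simp add: mult_left_le)
  finally have L: "1 \<le> L" .
  define w where "w = (1 / L) *\<^sub>R z"
  have w: "w = (\<Sum>i\<in>S. (m i / L) *\<^sub>R v i)"
    by (simp add: w_def z scaleR_sum_right)
  have "w \<in> convex hull (v ` S)"
    unfolding w
  proof (rule convex_sum)
    show "(\<Sum>i\<in>S. m i / L) = 1" using L by (simp add: L_def flip: sum_divide_distrib)
  qed (use assms(1) m L in \<open>auto intro: hull_inc\<close>)
  moreover have "dist z w \<le> chi 2 d"
  proof -
    have wn: "norm w = 1 / L" using L \<open>norm z = 1\<close> by (simp add: w_def)
    have "w \<bullet> a = (\<Sum>i\<in>S. (m i / L) * b)"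
      unfolding w inner_sum_left by (intro sum.cong) (simp_all add: a)
    also have "\<dots> = b" using L by (simp add: L_def flip: sum_distrib_right sum_divide_distrib)
    finally have "b\<^sup>2 \<le> (norm w)\<^sup>2 * (norm a)\<^sup>2"
      using Cauchy_Schwarz_ineq[of w a] by (simp add: power2_norm_eq_inner)
    with b have "(1 - d\<^sup>2 / 4) * (norm a)\<^sup>2 \<le> (norm w)\<^sup>2 * (norm a)\<^sup>2" by linarith
    then have "1 - d\<^sup>2 / 4 \<le> (norm w)\<^sup>2" using \<open>a \<noteq> 0\<close> by simp
    then have "1 - 1 / L \<le> chi 2 d" using L by (intro le_chi_two) (auto simp: wn)
    moreover have "z - w = (1 - 1 / L) *\<^sub>R z" by (simp add: w_def algebra_simps)
    then have "dist z w = 1 - 1 / L" using L \<open>norm z = 1\<close> by (simp add: dist_norm)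
    ultimately show ?thesis by simp
  qed
  ultimately show ?thesis by blast
qed

section \<open>Inverse stereographic projection\<close>

lemma invs_Fin_pos: "0 < 1 + (u::real)\<^sup>2 + v\<^sup>2"
  by (smt (verit) zero_le_power2)

lemma invs_Fin_scaleR:
  "invs (Fin (u, v)) = (1 / (1 + u\<^sup>2 + v\<^sup>2)) *\<^sub>R (2 * u, 2 * v, u\<^sup>2 + v\<^sup>2 - 1)"
  by (simp add: add_ac)

lemma norm_invs [simp]: "norm (invs z) = 1"
proof (cases z)
  case (Fin p)
  obtain u v where p: "p = (u, v)" by fastforce
  have "invs z \<bullet> invs z = ((2 * u)\<^sup>2 + (2 * v)\<^sup>2 + (u\<^sup>2 + v\<^sup>2 - 1)\<^sup>2) / (1 + u\<^sup>2 + v\<^sup>2)\<^sup>2"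
    unfolding Fin p invs_Fin_scaleR by (simp add: power2_eq_square add_divide_distrib)
  also have "(2 * u)\<^sup>2 + (2 * v)\<^sup>2 + (u\<^sup>2 + v\<^sup>2 - 1)\<^sup>2 = (1 + u\<^sup>2 + v\<^sup>2)\<^sup>2"
    by (simp add: power2_eq_square algebra_simps)
  finally show ?thesis using invs_Fin_pos[of u v] by (simp add: norm_eq_sqrt_inner)
qed simp

lemma inner_invs_Fin:
  "invs (Fin (a, b)) \<bullet> invs (Fin (c, e)) =
    1 - 2 * ((a - c)\<^sup>2 + (b - e)\<^sup>2) / ((1 + a\<^sup>2 + b\<^sup>2) * (1 + c\<^sup>2 + e\<^sup>2))"
proof -
  have "invs (Fin (a, b)) \<bullet> invs (Fin (c, e)) =
      (4 * a * c + 4 * b * e + (a\<^sup>2 + b\<^sup>2 - 1) * (c\<^sup>2 + e\<^sup>2 - 1)) / ((1 + a\<^sup>2 + b\<^sup>2) * (1 + c\<^sup>2 + e\<^sup>2))"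
    (is "_ = ?n / (?P * ?S)")
  proof -
    have "invs (Fin (a, b)) \<bullet> invs (Fin (c, e)) = (1 / ?P) * ((1 / ?S) * ?n)"
      unfolding invs_Fin_scaleR inner_scaleR_left inner_scaleR_right by (simp add: ac_simps)
    then show ?thesis by simp
  qed
  also have "4 * a * c + 4 * b * e + (a\<^sup>2 + b\<^sup>2 - 1) * (c\<^sup>2 + e\<^sup>2 - 1) =
      (1 + a\<^sup>2 + b\<^sup>2) * (1 + c\<^sup>2 + e\<^sup>2) - 2 * ((a - c)\<^sup>2 + (b - e)\<^sup>2)"
    by (simp add: power2_eq_square algebra_simps)
  finally show ?thesis
    using invs_Fin_pos[of a b] invs_Fin_pos[of c e] by (simp add: diff_divide_distrib)
qed

lemma dist_invs_Fin_sq: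
  "(dist (invs (Fin (a, b))) (invs (Fin (c, e))))\<^sup>2 =
    4 * ((a - c)\<^sup>2 + (b - e)\<^sup>2) / ((1 + a\<^sup>2 + b\<^sup>2) * (1 + c\<^sup>2 + e\<^sup>2))"
  using inner_invs_Fin[of a b c e]
  by (simp add: dist_norm power2_norm_eq_inner inner_diff_left inner_diff_right inner_commute
      del: invs.simps flip: dot_square_norm)
     (simp add: dot_square_norm del: invs.simps)

text \<open>These are the two sides of hypothesis \<open>n_dir\<close> of
  \<open>chord_projection\<close>, evaluated with the north pole as \<open>n\<close>. Everything
  reduces to the inner products of \<open>p\<close>, \<open>q\<close> and the pole, which are
  rational in \<open>P\<close>, \<open>S\<close> and the squared planar distance
  \<open>l\<close>.\<close>

lemma midpoint_invs_north:
  fixes a b c e :: real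
  defines "P \<equiv> 1 + a\<^sup>2 + b\<^sup>2" and "S \<equiv> 1 + c\<^sup>2 + e\<^sup>2"
    and "p \<equiv> invs (Fin (a, b))" and "q \<equiv> invs (Fin (c, e))"
  shows "midpoint p q \<bullet> (midpoint p q - invs Infty) = 2 * (1 + a * c + b * e) / (P * S)"
    and "(a, b) \<noteq> (c, e) \<Longrightarrow>
      (norm (midpoint p q - invs Infty - (((midpoint p q - invs Infty) \<bullet> (q - p)) / (dist p q)\<^sup>2) *\<^sub>R (q - p)))\<^sup>2
       = 4 * ((a - c)\<^sup>2 + (b - e)\<^sup>2 + (a * e - b * c)\<^sup>2) / (P * S * ((a - c)\<^sup>2 + (b - e)\<^sup>2))"
proof -
  define l where "l = (a - c)\<^sup>2 + (b - e)\<^sup>2"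
  define m n where "m = midpoint p q" and "n = invs Infty"
  have P: "P > 0" and S: "S > 0" unfolding P_def S_def by (rule invs_Fin_pos)+
  have pq: "p \<bullet> q = 1 - 2 * l / (P * S)"
    by (simp add: p_def q_def P_def S_def l_def inner_invs_Fin del: invs.simps)
  have pp: "p \<bullet> p = 1" "q \<bullet> q = 1" "n \<bullet> n = 1" by (simp_all add: p_def q_def n_def dot_square_norm del: invs.simps)
  have pn: "p \<bullet> n = 1 - 2 / P" "q \<bullet> n = 1 - 2 / S"
    using P S by (simp_all add: p_def q_def n_def P_def S_def field_simps)
  have mm: "m \<bullet> m = 1 - l / (P * S)"
    using P S pp pq by (simp add: m_def midpoint_def inner_simps inner_commute[of q p] field_simps)
  have mn: "m \<bullet> n = 1 - 1 / P - 1 / S"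
    using pn by (simp add: m_def midpoint_def inner_simps field_simps)
  have PSl: "P + S - l = 2 * (1 + a * c + b * e)"
    by (simp add: P_def S_def l_def power2_eq_square algebra_simps)
  have "m \<bullet> (m - n) = (P + S - l) / (P * S)"
    using P S by (simp add: inner_diff_right mm mn field_simps)
  then show "midpoint p q \<bullet> (midpoint p q - invs Infty) = 2 * (1 + a * c + b * e) / (P * S)"
    by (simp add: PSl m_def n_def)
  assume "(a, b) \<noteq> (c, e)"
  then have l: "l > 0" unfolding l_def
    by (metis eq_iff_diff_eq_0 sum_power2_gt_zero_iff)
  have d: "(dist p q)\<^sup>2 = 4 * l / (P * S)"
    by (simp add: p_def q_def dist_invs_Fin_sq l_def P_def S_def del: invs.simps)
  have qp: "(q - p) \<bullet> (q - p) = 4 * l / (P * S)"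
    unfolding d[symmetric] dist_norm power2_norm_eq_inner by (simp add: inner_simps inner_commute)
  have mnn: "(m - n) \<bullet> (m - n) = (2 * P + 2 * S - l) / (P * S)"
    using P S by (simp add: inner_diff_right inner_diff_left inner_commute[of n m] mm mn pp field_simps)
  have "m \<bullet> (q - p) = 0" using pp by (simp add: m_def midpoint_def inner_simps inner_commute)
  then have mne: "(m - n) \<bullet> (q - p) = 2 * (P - S) / (P * S)"
    using P S by (simp add: inner_diff_left inner_diff_right inner_commute[of n] pn) (simp add: field_simps)
  define t where "t = ((m - n) \<bullet> (q - p)) / (dist p q)\<^sup>2"
  have "(norm (m - n - t *\<^sub>R (q - p)))\<^sup>2
      = (m - n) \<bullet> (m - n) - 2 * t * ((m - n) \<bullet> (q - p)) + t\<^sup>2 * ((q - p) \<bullet> (q - p))"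
    unfolding power2_norm_eq_inner by (simp add: inner_simps inner_commute power2_eq_square algebra_simps)
  also have "\<dots> = (2 * P + 2 * S - l) / (P * S) - (P - S)\<^sup>2 / (P * S * l)"
    unfolding t_def mne d qp mnn using P S l by (simp add: power2_eq_square field_simps)
  also have "\<dots> = ((2 * P + 2 * S - l) * l - (P - S)\<^sup>2) / (P * S * l)"
    using P S l by (simp add: field_simps)
  also have "(2 * P + 2 * S - l) * l - (P - S)\<^sup>2 = 4 * (l + (a * e - b * c)\<^sup>2)"
    by (simp add: P_def S_def l_def power2_eq_square algebra_simps)
  finally show "(norm (midpoint p q - invs Infty - (((midpoint p q - invs Infty) \<bullet> (q - p)) / (dist p q)\<^sup>2) *\<^sub>R (q - p)))\<^sup>2
       = 4 * ((a - c)\<^sup>2 + (b - e)\<^sup>2 + (a * e - b * c)\<^sup>2) / (P * S * ((a - c)\<^sup>2 + (b - e)\<^sup>2))"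
    unfolding t_def m_def n_def l_def by (simp add: add_ac)
qed

text \<open>With the first two coordinates halved, \<open>comb\<close> writes the unnormalised lift
  of \<open>(x, y)\<close> plus \<open>\<nu>\<close> times the north pole as a combination of the
  lifts of the endpoints; dividing by \<open>W\<close> gives the setting of
  \<open>chord_projection\<close>. Hypothesis \<open>cross\<close> says that the line through the
  endpoints passes within distance sqrt 3 of the origin, that is, the circle through their images
  and the pole has diameter at least 1.\<close>

lemma edge_projection:
  fixes a b c e x y A B \<nu> :: real
  defines "l \<equiv> (a - c)\<^sup>2 + (b - e)\<^sup>2"
  assumes comb: "A * a + B * c = x" "A * b + B * e = y"
      "A * (a\<^sup>2 + b\<^sup>2 - 1) + B * (c\<^sup>2 + e\<^sup>2 - 1) = x\<^sup>2 + y\<^sup>2 - 1 + \<nu>"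
    and "0 \<le> \<nu>" "1 \<le> A + B" and l: "0 < l" "l \<le> 1/4"
    and cross: "(a * e - b * c)\<^sup>2 \<le> 3 * l" and dot: "0 \<le> 1 + a * c + b * e"
  shows "\<exists>w\<in>closed_segment (invs (Fin (a, b))) (invs (Fin (c, e))).
    dist (invs (Fin (x, y))) w \<le> chi 1 (dist (invs (Fin (a, b))) (invs (Fin (c, e))))"
proof -
  define P S W where "P = 1 + a\<^sup>2 + b\<^sup>2" and "S = 1 + c\<^sup>2 + e\<^sup>2" and "W = 1 + x\<^sup>2 + y\<^sup>2"
  define p q z where "p = invs (Fin (a, b))" and "q = invs (Fin (c, e))" and "z = invs (Fin (x, y))"
  define d where "d = dist p q"
  have P: "P \<ge> 1" and S: "S \<ge> 1" and W: "W > 0" by (simp_all add: P_def S_def W_def invs_Fin_pos)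
  have PS: "P * S \<ge> 1" using P S by (metis mult_mono' mult_1 zero_le_one)
  have d2: "d\<^sup>2 = 4 * l / (P * S)"
    by (simp add: d_def p_def q_def dist_invs_Fin_sq l_def P_def S_def del: invs.simps)
  also have "\<dots> \<le> 1" using PS l by (simp add: divide_le_eq)
  finally have d1: "d\<^sup>2 \<le> 1" .
  then have d1': "d \<le> 1" by (simp add: d_def abs_square_le_1)
  \<comment> \<open>In a circle of diameter 1 a chord of length \<open>d\<close> has squared
    distance \<open>(1 - d\<^sup>2) / 4\<close> from the centre. This \<open>r\<close> is a lower
    bound for that distance, polynomial in \<open>d\<^sup>2\<close> and matched to
    \<open>le_chi_one\<close>.\<close>
  define r where "r = (1 - d\<^sup>2) / 2"
  have pW: "p = (1 / P) *\<^sub>R (2 * a, 2 * b, a\<^sup>2 + b\<^sup>2 - 1)" "q = (1 / S) *\<^sub>R (2 * c, 2 * e, c\<^sup>2 + e\<^sup>2 - 1)"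
      "z = (1 / W) *\<^sub>R (2 * x, 2 * y, x\<^sup>2 + y\<^sup>2 - 1)"
    by (simp_all only: p_def q_def z_def P_def S_def W_def invs_Fin_scaleR)
  have main: "\<exists>w\<in>closed_segment p q. (dist z w)\<^sup>2 + 2 * r * dist z w \<le> (dist p q)\<^sup>2 / 4"
  proof (rule chord_projection)
    show "p \<noteq> q"
    proof
      assume "p = q"
      then have "d\<^sup>2 = 0" by (simp add: d_def)
      then show False using d2 l P S by simp
    qed
    have "(A * P / W) *\<^sub>R p + (B * S / W) *\<^sub>R q =
       (1 / W) *\<^sub>R (2 * (A * a + B * c), 2 * (A * b + B * e), A * (a\<^sup>2 + b\<^sup>2 - 1) + B * (c\<^sup>2 + e\<^sup>2 - 1))"
      unfolding pW using P S W by (simp add: field_simps)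
    also have "\<dots> = z + (\<nu> / W) *\<^sub>R invs Infty"
      unfolding comb pW by (simp add: add_divide_distrib diff_divide_distrib)
    finally show "z + (\<nu> / W) *\<^sub>R invs Infty = (A * P / W) *\<^sub>R p + (B * S / W) *\<^sub>R q" by simp
    \<comment> \<open>Adding 2 to the third equation of \<open>comb\<close> turns the lifts' last
      coordinates into \<open>P\<close>, \<open>S\<close> and \<open>W\<close>, and
      \<open>1 \<le> A + B\<close> pays for the 2.\<close>
    have "W + \<nu> \<le> A * P + B * S"
      using comb(3) \<open>1 \<le> A + B\<close> by (simp add: W_def P_def S_def algebra_simps)
    then show "1 + \<nu> / W \<le> A * P / W + B * S / W"
      using W divide_right_mono[of "W + \<nu>" "A * P + B * S" W] by (simp add: add_divide_distrib)
    show "0 \<le> \<nu> / W" using W \<open>0 \<le> \<nu>\<close> by simp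
    show r0: "0 \<le> r" using d1 by (simp add: r_def)
    have "(norm (midpoint p q))\<^sup>2 = 1 - d\<^sup>2 / 4"
    proof -
      have "p \<bullet> p = 1" "q \<bullet> q = 1" by (simp_all add: p_def q_def dot_square_norm del: invs.simps)
      then show ?thesis
        by (simp add: d_def dist_norm power2_norm_eq_inner midpoint_def inner_simps inner_commute field_simps)
    qed
    moreover have "r\<^sup>2 \<le> r" using d1 unfolding power2_eq_square[of r]
      by (intro mult_left_le) (auto simp: r_def intro: order_trans[OF _ zero_le_power2])
    moreover have "r \<le> 1 - d\<^sup>2 / 4" using d1 by (simp add: r_def field_simps)
    ultimately have "r\<^sup>2 \<le> (norm (midpoint p q))\<^sup>2" by linarith
    then show "r \<le> norm (midpoint p q)" by (rule power2_le_imp_le) simp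
    define k where "k = 1 + a * c + b * e"
    define X where "X = (a * e - b * c)\<^sup>2"
    have lag: "P * S = k\<^sup>2 + l + X"
      by (simp add: P_def S_def k_def l_def X_def power2_eq_square algebra_simps)
    have ne: "(a, b) \<noteq> (c, e)" using l by (auto simp: l_def)
    have "(1 - d\<^sup>2)\<^sup>2 \<le> 1 - d\<^sup>2" using d1 unfolding power2_eq_square[of "1 - d\<^sup>2"]
      by (intro mult_left_le) auto
    then have r2: "r\<^sup>2 \<le> (1 - d\<^sup>2) / 4" by (simp add: r_def power_divide)
    \<comment> \<open>This is the squared form of \<open>n_dir\<close>, cleared of denominators and
      with \<open>r\<^sup>2\<close> replaced by its bound \<open>r2\<close>. By Lagrange's identity
      \<open>lag\<close> the two sides differ by \<open>P * S * (3 * l - X)\<close>, so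
      \<open>cross\<close> is exactly the condition for it.\<close>
    have "(P * S - 4 * l) * (l + X) \<le> 4 * l * k\<^sup>2"
    proof -
      have "4 * l * k\<^sup>2 - (P * S - 4 * l) * (l + X) = P * S * (3 * l - X)"
        using lag by (simp add: algebra_simps)
      moreover have "0 \<le> P * S * (3 * l - X)" using cross PS by (simp add: X_def)
      ultimately show ?thesis by linarith
    qed
    then have "(P * S - 4 * l) * (l + X) / ((P * S)\<^sup>2 * l) \<le> 4 * l * k\<^sup>2 / ((P * S)\<^sup>2 * l)"
      using l by (intro divide_right_mono) auto
    moreover have "4 * l * k\<^sup>2 / ((P * S)\<^sup>2 * l) = (2 * k / (P * S))\<^sup>2"
      using l by (simp add: power_divide power_mult_distrib)
    moreover have "(1 - d\<^sup>2) / 4 * (4 * (l + X) / (P * S * l)) = (P * S - 4 * l) * (l + X) / ((P * S)\<^sup>2 * l)"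
      unfolding d2 using P S l by (simp add: power2_eq_square field_simps)
    moreover have "r\<^sup>2 * (4 * (l + X) / (P * S * l)) \<le> (1 - d\<^sup>2) / 4 * (4 * (l + X) / (P * S * l))"
      using r2 l PS by (intro mult_right_mono) (auto simp: X_def)
    ultimately have "r\<^sup>2 * (4 * (l + X) / (P * S * l)) \<le> (2 * k / (P * S))\<^sup>2" by linarith
    then have "(r * norm (midpoint p q - invs Infty - (((midpoint p q - invs Infty) \<bullet> (q - p)) / (dist p q)\<^sup>2) *\<^sub>R (q - p)))\<^sup>2
        \<le> (midpoint p q \<bullet> (midpoint p q - invs Infty))\<^sup>2"
      using midpoint_invs_north(1)[of a b c e] midpoint_invs_north(2)[OF ne]
      unfolding power_mult_distrib p_def[symmetric] q_def[symmetric] P_def[symmetric] S_def[symmetric]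
        l_def[symmetric] X_def[symmetric] k_def[symmetric] by (simp del: invs.simps)
    moreover have "0 \<le> midpoint p q \<bullet> (midpoint p q - invs Infty)"
      using midpoint_invs_north(1)[of a b c e] dot PS
      unfolding p_def[symmetric] q_def[symmetric] P_def[symmetric] S_def[symmetric] by (simp del: invs.simps)
    ultimately show "r * norm (midpoint p q - invs Infty - (((midpoint p q - invs Infty) \<bullet> (q - p)) / (dist p q)\<^sup>2) *\<^sub>R (q - p))
        \<le> midpoint p q \<bullet> (midpoint p q - invs Infty)"
      by (rule power2_le_imp_le)
  qed (simp_all add: p_def q_def z_def del: invs.simps)
  then obtain w where w: "w \<in> closed_segment p q" "(dist z w)\<^sup>2 + 2 * r * dist z w \<le> d\<^sup>2 / 4"
    unfolding d_def by blast
  have "dist z w \<le> chi 1 d"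
    by (rule le_chi_one) (use w d1' in \<open>auto simp: r_def d_def\<close>)
  then show ?thesis using w unfolding d_def p_def q_def z_def by blast
qed

section \<open>Circles in the plane and their images on the sphere\<close>

lemma DQ_eq_cball:
  assumes "p \<in> vsetR Q" "q \<in> vsetR Q" "vsetR Q \<subseteq> sphere c r" "dist p q = 2 * r"
  shows "DQ Q = cball c r"
  unfolding DQ_def
proof (rule the_equality)
  \<comment> \<open>By the parallelogram identity, two points at distance \<open>2 * r\<close> have
    only their midpoint at distance \<open>r\<close> from both. This gives the uniqueness behind the
    definite description in \<open>DQ\<close>.\<close>
  have center: "2 *\<^sub>R c' = p + q" if "dist c' p = r" "dist c' q = r" for c'
  proof -
    have "(norm (p + q - 2 *\<^sub>R c'))\<^sup>2 = 2 * (dist c' p)\<^sup>2 + 2 * (dist c' q)\<^sup>2 - (dist p q)\<^sup>2"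
      unfolding dist_norm power2_norm_eq_inner
      by (simp add: inner_simps inner_commute algebra_simps)
    also have "\<dots> = 0" using that assms(4) by (simp add: power_mult_distrib)
    finally show ?thesis by simp
  qed
  have radius: "r \<le> r'" if "vsetR Q \<subseteq> sphere c' r'" for c' r'
  proof -
    have "dist c' p = r'" "dist c' q = r'" using that assms(1,2) by auto
    then show ?thesis using dist_triangle3[of p q c'] assms(4) by simp
  qed
  show "\<exists>c' r'. cball c r = cball c' r' \<and> vsetR Q \<subseteq> sphere c' r' \<and>
      (\<forall>c'' r''. vsetR Q \<subseteq> sphere c'' r'' \<longrightarrow> r' \<le> r'')"
    using assms(3) radius by blast
  fix D
  assume "\<exists>c' r'. D = cball c' r' \<and> vsetR Q \<subseteq> sphere c' r' \<and>
      (\<forall>c'' r''. vsetR Q \<subseteq> sphere c'' r'' \<longrightarrow> r' \<le> r'')"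
  then obtain c' r' where D: "D = cball c' r'" "vsetR Q \<subseteq> sphere c' r'" "r' \<le> r"
    using assms(3) by blast
  then have "r' = r" using radius[of c' r'] by simp
  then have "dist c' p = r" "dist c' q = r" "dist c p = r" "dist c q = r"
    using D assms(1-3) by auto
  then have "2 *\<^sub>R c' = 2 *\<^sub>R c" using center by metis
  then show "D = cball c r" using D \<open>r' = r\<close> by simp
qed

text \<open>For a point \<open>(X, Y, Z)\<close> of the sphere other than the pole, substitute u =
  X/(1-Z), v = Y/(1-Z) and u^2 + v^2 = (1+Z)/(1-Z) in the circle's equation. Clearing denominators
  leaves a linear equation, in which c1^2 + c2^2 - r^2 is the power of the origin.\<close>

lemma invs_circle_plane:
  assumes "(u - c1)\<^sup>2 + (v - c2)\<^sup>2 = r\<^sup>2"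
  shows "invs (Fin (u, v)) \<bullet> (- 2 * c1, - 2 * c2, 1 - (c1\<^sup>2 + c2\<^sup>2 - r\<^sup>2)) = - (1 + (c1\<^sup>2 + c2\<^sup>2 - r\<^sup>2))"
proof -
  have "invs (Fin (u, v)) \<bullet> (- 2 * c1, - 2 * c2, 1 - (c1\<^sup>2 + c2\<^sup>2 - r\<^sup>2))
    = (1 / (1 + u\<^sup>2 + v\<^sup>2)) * (- 4 * u * c1 - 4 * v * c2 + (u\<^sup>2 + v\<^sup>2 - 1) * (1 - (c1\<^sup>2 + c2\<^sup>2 - r\<^sup>2)))"
    unfolding invs_Fin_scaleR inner_scaleR_left by simp
  also have "- 4 * u * c1 - 4 * v * c2 + (u\<^sup>2 + v\<^sup>2 - 1) * (1 - (c1\<^sup>2 + c2\<^sup>2 - r\<^sup>2))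
    = - (1 + u\<^sup>2 + v\<^sup>2) * (1 + (c1\<^sup>2 + c2\<^sup>2 - r\<^sup>2))"
    unfolding assms[symmetric] by (simp add: power2_eq_square algebra_simps)
  also have "(1 / (1 + u\<^sup>2 + v\<^sup>2)) * (- (1 + u\<^sup>2 + v\<^sup>2) * (1 + (c1\<^sup>2 + c2\<^sup>2 - r\<^sup>2)))
    = - (1 + (c1\<^sup>2 + c2\<^sup>2 - r\<^sup>2))"
  proof -
    have "(1 / D) * (- D * X) = - X" if "0 < D" for D X :: real using that by simp
    then show ?thesis using invs_Fin_pos by blast
  qed
  finally show ?thesis .
qed

text \<open>The bound is attained: the two points of the circle on its diameter through the origin go to
  antipodal points of the image circle.\<close>

lemma invs_cball_diameter:
  fixes c1 c2 r :: real
  assumes "0 \<le> r"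
  shows "16 * r\<^sup>2 / ((1 - (c1\<^sup>2 + c2\<^sup>2 - r\<^sup>2))\<^sup>2 + 4 * (c1\<^sup>2 + c2\<^sup>2)) \<le> (diameter (invsR ` cball (c1, c2) r))\<^sup>2"
proof -
  \<comment> \<open>Polar form of the centre; if the centre is the origin, every diameter serves and
    the direction \<open>(1, 0)\<close> is taken.\<close>
  obtain \<rho> n1 n2 where c: "c1 = \<rho> * n1" "c2 = \<rho> * n2" and n: "n1\<^sup>2 + n2\<^sup>2 = (1::real)"
  proof (cases "c1 = 0 \<and> c2 = 0")
    case True
    then show ?thesis using that[of 0 1 0] by simp
  next
    case False
    define \<rho> where "\<rho> = sqrt (c1\<^sup>2 + c2\<^sup>2)"
    have "\<rho>\<^sup>2 = c1\<^sup>2 + c2\<^sup>2" "\<rho> \<noteq> 0" using False by (auto simp: \<rho>_def)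
    moreover from this have "(c1 / \<rho>)\<^sup>2 + (c2 / \<rho>)\<^sup>2 = 1"
      by (metis add_divide_distrib divide_self power_divide power_not_zero)
    ultimately show ?thesis using that[of \<rho> "c1 / \<rho>" "c2 / \<rho>"] by simp
  qed
  define u v where "u = ((\<rho> + r) * n1, (\<rho> + r) * n2)" and "v = ((\<rho> - r) * n1, (\<rho> - r) * n2)"
  have sq: "(t * n1)\<^sup>2 + (t * n2)\<^sup>2 = t\<^sup>2" for t
    using n by (simp add: power_mult_distrib flip: distrib_left)
  have "dist (c1, c2) u = sqrt ((r * n1)\<^sup>2 + (r * n2)\<^sup>2)" "dist (c1, c2) v = sqrt ((r * n1)\<^sup>2 + (r * n2)\<^sup>2)"
    by (simp_all add: u_def v_def c dist_Pair_Pair dist_real_def algebra_simps)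
  then have mem: "u \<in> cball (c1, c2) r" "v \<in> cball (c1, c2) r" using assms by (simp_all add: sq)
  have "norm y \<le> 1" if "y \<in> invsR ` cball (c1, c2) r" for y
    using that by (auto simp: invsR_def simp del: invs.simps)
  then have "bounded (invsR ` cball (c1, c2) r)" by (meson boundedI)
  then have "dist (invsR u) (invsR v) \<le> diameter (invsR ` cball (c1, c2) r)"
    using mem by (intro diameter_bounded_bound) auto
  then have "(dist (invsR u) (invsR v))\<^sup>2 \<le> (diameter (invsR ` cball (c1, c2) r))\<^sup>2"
    by (intro power_mono) auto
  moreover have diffs: "(\<rho> + r) * n1 - (\<rho> - r) * n1 = 2 * r * n1" "(\<rho> + r) * n2 - (\<rho> - r) * n2 = 2 * r * n2"
    by (simp_all add: algebra_simps)
  have "(dist (invsR u) (invsR v))\<^sup>2 = 16 * r\<^sup>2 / ((1 + (\<rho> + r)\<^sup>2) * (1 + (\<rho> - r)\<^sup>2))"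
    unfolding u_def v_def invsR_def dist_invs_Fin_sq diffs add.assoc sq by (simp add: power_mult_distrib)
  moreover have "(1 - (c1\<^sup>2 + c2\<^sup>2 - r\<^sup>2))\<^sup>2 + 4 * (c1\<^sup>2 + c2\<^sup>2) = (1 + (\<rho> + r)\<^sup>2) * (1 + (\<rho> - r)\<^sup>2)"
    unfolding c sq by (simp add: power2_eq_square algebra_simps)
  ultimately show ?thesis by simp
qed

lemma circle_radial_approx:
  assumes "Q \<noteq> DInf" and sph: "vsetR Q \<subseteq> sphere (c1, c2) r" and DQ: "DQ Q = cball (c1, c2) r"
    and m: "\<And>i. i \<in> {1..4} \<Longrightarrow> 0 \<le> m i"
    and z: "invs z = (\<Sum>i=1..4. m i *\<^sub>R invs (verts Q i))"
  shows "\<exists>w\<in>hullQhat Q. dist (invs z) w \<le> chi 2 (d2Q Q)"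
proof -
  define \<gamma> where "\<gamma> = c1\<^sup>2 + c2\<^sup>2 - r\<^sup>2"
  define a where "a = (- 2 * c1, - 2 * c2, 1 - \<gamma>)"
  have na: "(norm a)\<^sup>2 = (1 - \<gamma>)\<^sup>2 + 4 * (c1\<^sup>2 + c2\<^sup>2)"
    unfolding power2_norm_eq_inner a_def by (simp add: power2_eq_square algebra_simps)
  have "vertsR Q 1 \<in> sphere (c1, c2) r" using sph by (force simp: vsetR_def)
  then have r: "0 \<le> r" by auto
  \<comment> \<open>This second form of the norm shows that the plane cuts the sphere in a circle of
    squared radius \<open>4 * r\<^sup>2 / (norm a)\<^sup>2\<close>, which is what hypothesis
    \<open>b\<close> of \<open>radial_projection\<close> needs to be compared with
    \<open>d2Q Q\<close>.\<close>
  have na2: "(norm a)\<^sup>2 = (1 + \<gamma>)\<^sup>2 + 4 * r\<^sup>2"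
    unfolding na by (simp add: \<gamma>_def power2_eq_square algebra_simps)
  have "a \<noteq> 0"
  proof
    assume "a = 0"
    then have "c1 = 0" "c2 = 0" "\<gamma> = 1" by (simp_all add: a_def zero_prod_def)
    then have "r\<^sup>2 = - 1" by (simp add: \<gamma>_def)
    then show False by (metis neg_0_le_iff_le not_one_le_zero zero_le_power2)
  qed
  then have na0: "(norm a)\<^sup>2 > 0" by simp
  have "16 * r\<^sup>2 / (norm a)\<^sup>2 \<le> (d2Q Q)\<^sup>2"
    using invs_cball_diameter[OF r, of c1 c2] unfolding na \<gamma>_def d2Q_def DQ by simp
  then have "4 * (4 * r\<^sup>2) \<le> (d2Q Q)\<^sup>2 * (norm a)\<^sup>2" using na0 by (simp add: field_simps)
  then have b: "(1 - (d2Q Q)\<^sup>2 / 4) * (norm a)\<^sup>2 \<le> (- (1 + \<gamma>))\<^sup>2"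
    using na2 unfolding power2_minus by (simp add: left_diff_distrib)
  have inner: "invs (verts Q i) \<bullet> a = - (1 + \<gamma>)" if "i \<in> {1..4}" for i
  proof -
    obtain u v where uv: "vertsR Q i = (u, v)" by fastforce
    have "(u, v) \<in> sphere (c1, c2) r" using sph that unfolding vsetR_def uv[symmetric] by blast
    then have "(u - c1)\<^sup>2 + (v - c2)\<^sup>2 = r\<^sup>2"
      by (auto simp: dist_Pair_Pair dist_real_def power2_commute)
    then show ?thesis using \<open>Q \<noteq> DInf\<close> invs_circle_plane[of u c1 v c2 r]
      by (simp add: verts_def uv a_def \<gamma>_def del: invs.simps)
  qed
  show ?thesis unfolding hullQhat_def
    by (rule radial_projection[OF _ m z _ _ inner \<open>a \<noteq> 0\<close> b]) auto
qed

section \<open>Sides of a square and the cone over its lifted vertices\<close>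

lemma vertical_edge_approx:
  fixes X x y y0 y1 :: real
  assumes "X \<noteq> 0" "1 \<le> x / X" "X\<^sup>2 \<le> 3" "y0 < y1" "y1 - y0 \<le> 1/2" "0 \<le> 1 + X\<^sup>2 + y0 * y1"
    and nonneg: "0 \<le> x * (X - x) + (y - y0) * (y1 - y) - (x / X - 1) * (1 + y0 * y1)"
  shows "\<exists>w\<in>closed_segment (invs (Fin (X, y0))) (invs (Fin (X, y1))).
    dist (invs (Fin (x, y))) w \<le> chi 1 (dist (invs (Fin (X, y0))) (invs (Fin (X, y1))))"
proof -
  define s L where "s = y1 - y0" and "L = x / X"
  have s: "s > 0" "s \<le> 1/2" and y1: "y1 = y0 + s" using assms by (simp_all add: s_def)
  have x: "x = L * X" using assms(1) by (simp add: L_def)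
  have "s * s \<le> (1/2) * (1/2)" using s by (intro mult_mono) auto
  then have s2: "s\<^sup>2 \<le> 1/4" by (simp add: power2_eq_square)
  \<comment> \<open>The two weights are forced by the planar equations: they sum to
    \<open>L = x / X\<close> and average the heights \<open>y0\<close>, \<open>y1\<close> to
    \<open>y\<close>. The third equation then determines \<open>\<nu>\<close>, and
    \<open>nonneg\<close> is the condition that it be nonnegative.\<close>
  have AB: "(L * y1 - y) / s + (y - L * y0) / s = L"
    using s by (simp add: y1 field_simps)
  show ?thesis
  proof (rule edge_projection[where A = "(L * y1 - y) / s" and B = "(y - L * y0) / s"])
    show "(L * y1 - y) / s * X + (y - L * y0) / s * X = x"
      unfolding distrib_right[symmetric] AB x ..
    show "(L * y1 - y) / s * y0 + (y - L * y0) / s * y1 = y"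
      using s by (simp add: y1 field_simps)
    have "(L * y1 - y) / s * (X\<^sup>2 + y0\<^sup>2 - 1) + (y - L * y0) / s * (X\<^sup>2 + y1\<^sup>2 - 1)
        = L * (X\<^sup>2 - 1) + ((L * y1 - y) * y0\<^sup>2 + (y - L * y0) * y1\<^sup>2) / s"
      using s by (simp add: y1 field_simps)
    also have "((L * y1 - y) * y0\<^sup>2 + (y - L * y0) * y1\<^sup>2) / s = y * (y0 + y1) - L * y0 * y1"
      using s by (simp add: y1 power2_eq_square field_simps)
    finally show "(L * y1 - y) / s * (X\<^sup>2 + y0\<^sup>2 - 1) + (y - L * y0) / s * (X\<^sup>2 + y1\<^sup>2 - 1)
        = x\<^sup>2 + y\<^sup>2 - 1 + (x * (X - x) + (y - y0) * (y1 - y) - (L - 1) * (1 + y0 * y1))"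
      unfolding x by (simp add: power2_eq_square algebra_simps)
    show "0 \<le> x * (X - x) + (y - y0) * (y1 - y) - (L - 1) * (1 + y0 * y1)"
      using nonneg by (simp add: L_def)
    show "1 \<le> (L * y1 - y) / s + (y - L * y0) / s" unfolding AB using assms by (simp add: L_def)
    show "(X * y1 - y0 * X)\<^sup>2 \<le> 3 * ((X - X)\<^sup>2 + (y0 - y1)\<^sup>2)"
    proof -
      have "(X * y1 - y0 * X)\<^sup>2 = X\<^sup>2 * s\<^sup>2" by (simp add: y1 power2_eq_square algebra_simps)
      also have "\<dots> \<le> 3 * s\<^sup>2" using assms by (intro mult_right_mono) auto
      finally show ?thesis by (simp add: s_def power2_commute)
    qed
    show "0 \<le> 1 + X * X + y0 * y1" using assms by (simp add: power2_eq_square)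
  qed (use s s2 in \<open>auto simp: y1\<close>)
qed

lemma horizontal_edge_approx:
  fixes Y y x x0 x1 :: real
  assumes "Y \<noteq> 0" "1 \<le> y / Y" "Y\<^sup>2 \<le> 3" "x0 < x1" "x1 - x0 \<le> 1/2" "0 \<le> 1 + Y\<^sup>2 + x0 * x1"
    and nonneg: "0 \<le> y * (Y - y) + (x - x0) * (x1 - x) - (y / Y - 1) * (1 + x0 * x1)"
  shows "\<exists>w\<in>closed_segment (invs (Fin (x0, Y))) (invs (Fin (x1, Y))).
    dist (invs (Fin (x, y))) w \<le> chi 1 (dist (invs (Fin (x0, Y))) (invs (Fin (x1, Y))))"
proof -
  \<comment> \<open>Exchanging the first two coordinates is a linear isometry compatible with the
    lift, so the vertical case carries over.\<close>
  define swap :: "real \<times> real \<times> real \<Rightarrow> real \<times> real \<times> real" where "swap = (\<lambda>(a, b, c). (b, a, c))"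
  have swap: "swap (invs (Fin (u, v))) = invs (Fin (v, u))" for u v
    by (simp add: swap_def add_ac)
  have lin: "linear swap" by (rule linearI) (auto simp: swap_def)
  have dist: "dist (swap a) (swap b) = dist a b" for a b
    by (cases a, cases b) (auto simp: swap_def dist_Pair_Pair add_ac)
  obtain w where w: "w \<in> closed_segment (invs (Fin (Y, x0))) (invs (Fin (Y, x1)))"
      "dist (invs (Fin (y, x))) w \<le> chi 1 (dist (invs (Fin (Y, x0))) (invs (Fin (Y, x1))))"
    using vertical_edge_approx[OF assms] by blast
  show ?thesis
  proof
    show "swap w \<in> closed_segment (invs (Fin (x0, Y))) (invs (Fin (x1, Y)))"
      using imageI[OF w(1), of swap] unfolding closed_segment_linear_image[OF lin, symmetric] swap .
    show "dist (invs (Fin (x, y))) (swap w) \<le> chi 1 (dist (invs (Fin (x0, Y))) (invs (Fin (x1, Y))))"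
      using w(2) dist[of "invs (Fin (y, x))" w] dist[of "invs (Fin (Y, x0))" "invs (Fin (Y, x1))"]
      unfolding swap by simp
  qed
qed

text \<open>The lifts \<open>V u v = (2 u, 2 v, u\<^sup>2 + v\<^sup>2 - 1)\<close> of the vertices form a parallelogram, and
  \<open>V x y\<close> is the bilinear interpolation of these lifts minus \<open>\<kappa>\<close> times the north pole. Expanding the
  pole in the parallelogram basis (whence \<open>M\<close>) turns membership in the cone into four inequalities.\<close>

lemma square_cone:
  fixes x0 x1 y0 y1 x y s :: real
  defines "M \<equiv> 1 + x0 * x1 + y0 * y1" and "\<kappa> \<equiv> (x - x0) * (x1 - x) + (y - y0) * (y1 - y)"
  assumes s: "0 < s" "x1 = x0 + s" "y1 = y0 + s" and "0 < M" "0 \<le> \<kappa>"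
    and cone: "\<kappa> * x0 \<le> (x - x0) * M" "- \<kappa> * x1 \<le> (x1 - x) * M"
      "\<kappa> * y0 \<le> (y - y0) * M" "- \<kappa> * y1 \<le> (y1 - y) * M"
  obtains m1 m2 m3 m4 where "0 \<le> m1" "0 \<le> m2" "0 \<le> m3" "0 \<le> m4"
    "invs (Fin (x, y)) = m1 *\<^sub>R invs (Fin (x0, y0)) + m2 *\<^sub>R invs (Fin (x1, y0)) +
    m3 *\<^sub>R invs (Fin (x1, y1)) + m4 *\<^sub>R invs (Fin (x0, y1))"
proof -
  \<comment> \<open>\<open>L\<close> is the total weight of the combination of unnormalised lifts,
    and \<open>a\<close>, \<open>b\<close> are the bilinear coordinates of
    \<open>(x / L, y / L)\<close> in the square. Matching the last coordinate requires
    \<open>L * M = M + \<kappa>\<close>.\<close>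
  define L where "L = 1 + \<kappa> / M"
  have L: "L \<ge> 1" using assms by (simp add: L_def)
  define a b where "a = (x / L - x0) / s" and "b = (y / L - y0) / s"
  have LM: "L * M = M + \<kappa>" using \<open>0 < M\<close> by (simp add: L_def field_simps)
  \<comment> \<open>In this form the four cone inequalities say that \<open>(x / L, y / L)\<close>
    lies in the square.\<close>
  have bounds: "L * x0 \<le> x" "x \<le> L * x1" "L * y0 \<le> y" "y \<le> L * y1"
    using cone \<open>0 < M\<close> by (simp_all add: L_def field_simps)
  have a: "0 \<le> a" "a \<le> 1" and b: "0 \<le> b" "b \<le> 1"
    using L s(1) bounds by (simp_all add: a_def b_def field_simps s(2,3))
  have xa: "L * (x0 + a * s) = x" and yb: "L * (y0 + b * s) = y"
    using L s(1) by (simp_all add: a_def b_def)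
  define V where "V u v = (2 * u, 2 * v, u\<^sup>2 + v\<^sup>2 - 1 :: real)" for u v :: real
  have V: "V u v = (1 + u\<^sup>2 + v\<^sup>2) *\<^sub>R invs (Fin (u, v))" for u v
    using invs_Fin_pos[of u v] by (simp add: V_def invs_Fin_scaleR del: invs.simps)
  have "V x y = (L * (1 - a) * (1 - b)) *\<^sub>R V x0 y0 + (L * a * (1 - b)) *\<^sub>R V x1 y0
     + (L * a * b) *\<^sub>R V x1 y1 + (L * (1 - a) * b) *\<^sub>R V x0 y1"
  proof -
    have "2 * x = L * (1 - a) * (1 - b) * (2 * x0) + L * a * (1 - b) * (2 * x1) + L * a * b * (2 * x1)
      + L * (1 - a) * b * (2 * x0)"
      unfolding xa[symmetric] s(2) by (simp add: algebra_simps)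
    moreover have "2 * y = L * (1 - a) * (1 - b) * (2 * y0) + L * a * (1 - b) * (2 * y0) + L * a * b * (2 * y1)
      + L * (1 - a) * b * (2 * y1)"
      unfolding yb[symmetric] s(3) by (simp add: algebra_simps)
    moreover have "x\<^sup>2 + y\<^sup>2 - 1 = L * (1 - a) * (1 - b) * (x0\<^sup>2 + y0\<^sup>2 - 1) + L * a * (1 - b) * (x1\<^sup>2 + y0\<^sup>2 - 1)
      + L * a * b * (x1\<^sup>2 + y1\<^sup>2 - 1) + L * (1 - a) * b * (x0\<^sup>2 + y1\<^sup>2 - 1)"
    proof -
      have "x\<^sup>2 + y\<^sup>2 - 1 = - (M + \<kappa>) + x * (x0 + x1) + y * (y0 + y1)"
        by (simp add: M_def \<kappa>_def power2_eq_square algebra_simps)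
      also have "\<dots> = - (L * M) + L * (x0 + a * s) * (x0 + x1) + L * (y0 + b * s) * (y0 + y1)"
        unfolding LM xa yb ..
      also have "\<dots> = L * (1 - a) * (1 - b) * (x0\<^sup>2 + y0\<^sup>2 - 1) + L * a * (1 - b) * (x1\<^sup>2 + y0\<^sup>2 - 1)
        + L * a * b * (x1\<^sup>2 + y1\<^sup>2 - 1) + L * (1 - a) * b * (x0\<^sup>2 + y1\<^sup>2 - 1)"
        unfolding M_def s(2,3) by (simp add: power2_eq_square algebra_simps)
      finally show ?thesis .
    qed
    ultimately show ?thesis unfolding V_def scaleR_Pair add_Pair real_scaleR_def prod.inject by blast
  qed
  then have "invs (Fin (x, y)) = (1 / (1 + x\<^sup>2 + y\<^sup>2)) *\<^sub>R ((L * (1 - a) * (1 - b)) *\<^sub>R V x0 y0 + (L * a * (1 - b)) *\<^sub>R V x1 y0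
     + (L * a * b) *\<^sub>R V x1 y1 + (L * (1 - a) * b) *\<^sub>R V x0 y1)"
    by (metis V_def invs_Fin_scaleR)
  then have "invs (Fin (x, y)) =
      (L * (1 - a) * (1 - b) * (1 + x0\<^sup>2 + y0\<^sup>2) / (1 + x\<^sup>2 + y\<^sup>2)) *\<^sub>R invs (Fin (x0, y0)) +
      (L * a * (1 - b) * (1 + x1\<^sup>2 + y0\<^sup>2) / (1 + x\<^sup>2 + y\<^sup>2)) *\<^sub>R invs (Fin (x1, y0)) +
      (L * a * b * (1 + x1\<^sup>2 + y1\<^sup>2) / (1 + x\<^sup>2 + y\<^sup>2)) *\<^sub>R invs (Fin (x1, y1)) +
      (L * (1 - a) * b * (1 + x0\<^sup>2 + y1\<^sup>2) / (1 + x\<^sup>2 + y\<^sup>2)) *\<^sub>R invs (Fin (x0, y1))"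
    unfolding V by (simp add: scaleR_add_right del: invs.simps)
  from that[OF _ _ _ _ this] show thesis using L a b by simp
qed

section \<open>Distance to the hull of the lifted vertices\<close>

lemma one_to_four: "{1..4::nat} = {1, 2, 3, 4}" by auto

lemma side_pos: "0 < side n" by (simp add: side_def)

text \<open>The segment lies on the x-axis, so its image lies on a great circle and every point of
  it is in the cone over the two lifted endpoints. Hence radial projection always applies, with the
  circle having the segment as diameter.\<close>

lemma segment_hull_approx:
  assumes "z \<in> hullQ (DSeg n j)"
  shows "\<exists>w\<in>hullQhat (DSeg n j). dist (invs z) w \<le> chi 2 (d2Q (DSeg n j))"
proof -
  define Q a b where "Q = DSeg n j" and "a = side n * j" and "b = side n * (j + 1)"
  have "side n * j < side n * (j + 1)" "0 \<le> side n * j"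
    using side_pos[of n] by (simp_all add: algebra_simps)
  then have ab: "a < b" "0 \<le> a" by (simp_all add: a_def b_def)
  have "Q \<noteq> DInf" by (simp add: Q_def)
  have vR: "vertsR Q i = (if i = 1 \<or> i = 3 then (a, 0) else (b, 0))" for i
    by (simp add: Q_def a_def b_def)
  have vs: "vsetR Q = {(a, 0), (b, 0)}" unfolding vsetR_def one_to_four by (auto simp: vR)
  have "convex hull vsetR Q \<subseteq> {a..b} \<times> {0}"
    using ab unfolding vs by (intro hull_minimal convex_Times) auto
  then obtain x where x: "z = Fin (x, 0)" "a \<le> x" "x \<le> b"
    using assms by (auto simp: hullQ_def Q_def)
  define D W where "D = (b - a) * (a * b + 1)" and "W = 1 + x\<^sup>2"
  have "0 \<le> a * b" using ab by simp
  then have D: "D > 0" using ab by (simp add: D_def add_nonneg_pos)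
  have W: "W > 0" by (simp add: W_def add_pos_nonneg)
  \<comment> \<open>Cramer's rule for the lifts in the plane of the great circle: \<open>D\<close>
    is half the determinant of the endpoint lifts \<open>(2 * a, a\<^sup>2 - 1)\<close> and
    \<open>(2 * b, b\<^sup>2 - 1)\<close>. The factors \<open>1 + a\<^sup>2\<close>,
    \<open>1 + b\<^sup>2\<close> and \<open>W\<close> pass to the normalised lifts. Vertices 3 and 4
    repeat the endpoints and get weight 0.\<close>
  define A B where "A = (b - x) * (b * x + 1) / D * (1 + a\<^sup>2) / W" and "B = (x - a) * (a * x + 1) / D * (1 + b\<^sup>2) / W"
  have AB: "0 \<le> A" "0 \<le> B"
    using ab x D W by (simp_all add: A_def B_def)
  define m where "m i = (if i = 1 then A else if i = 2 then B else 0)" for i :: nat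
  have e1: "(b - x) * (b * x + 1) * a + (x - a) * (a * x + 1) * b = D * x"
    and e2: "(b - x) * (b * x + 1) * (a\<^sup>2 - 1) + (x - a) * (a * x + 1) * (b\<^sup>2 - 1) = D * (x\<^sup>2 - 1)"
    by (simp_all add: D_def power2_eq_square algebra_simps)
  have "A *\<^sub>R invs (Fin (a, 0)) + B *\<^sub>R invs (Fin (b, 0)) =
     (1 / (D * W)) *\<^sub>R (2 * ((b - x) * (b * x + 1) * a + (x - a) * (a * x + 1) * b), 0,
       (b - x) * (b * x + 1) * (a\<^sup>2 - 1) + (x - a) * (a * x + 1) * (b\<^sup>2 - 1))"
  proof -
    have a1: "A *\<^sub>R invs (Fin (a, 0)) = (1 / (D * W)) *\<^sub>R (((b - x) * (b * x + 1)) *\<^sub>R (2 * a, 0, a\<^sup>2 - 1))"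
      using invs_Fin_pos[of a 0] by (simp add: A_def invs_Fin_scaleR del: invs.simps scaleR_Pair)
    have b1: "B *\<^sub>R invs (Fin (b, 0)) = (1 / (D * W)) *\<^sub>R (((x - a) * (a * x + 1)) *\<^sub>R (2 * b, 0, b\<^sup>2 - 1))"
      using invs_Fin_pos[of b 0] by (simp add: B_def invs_Fin_scaleR del: invs.simps scaleR_Pair)
    show ?thesis unfolding a1 b1 scaleR_add_right[symmetric] by simp
  qed
  also have "\<dots> = invs z"
    unfolding e1 e2 x invs_Fin_scaleR using D by (simp add: W_def)
  finally have "invs z = (\<Sum>i=1..4. m i *\<^sub>R invs (verts Q i))"
    unfolding one_to_four by (simp add: m_def verts_def vR \<open>Q \<noteq> DInf\<close> del: invs.simps vertsR.simps)
  moreover have sph: "vsetR Q \<subseteq> sphere ((a + b) / 2, 0) ((b - a) / 2)"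
  proof -
    have "\<bar>(a + b) / 2 - a\<bar> = (b - a) / 2" "\<bar>(a + b) / 2 - b\<bar> = (b - a) / 2"
      using ab by (simp_all add: abs_if field_simps)
    then show ?thesis unfolding vs by (simp add: dist_Pair_Pair dist_real_def)
  qed
  moreover have "DQ Q = cball ((a + b) / 2, 0) ((b - a) / 2)"
    by (rule DQ_eq_cball[of "(a, 0)" _ "(b, 0)"]) (use sph ab in \<open>auto simp: vs dist_Pair_Pair dist_real_def\<close>)
  ultimately show ?thesis
    using circle_radial_approx[of Q "(a + b) / 2" 0 "(b - a) / 2" m z] AB
    by (auto simp: Q_def m_def)
qed

text \<open>The cases are the inequalities of \<open>square_cone\<close>. If all hold, radial
  projection with the circumscribed circle gives the \<open>chi 2\<close> bound; if one fails, it
  singles out a side facing the origin, and projection to that side's chord gives the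
  \<open>chi 1\<close> bound.\<close>

lemma square_hull_approx:
  assumes valid: "valid_obj (DSq n i j)" and "z \<in> hullQ (DSq n i j)"
  shows "\<exists>w\<in>hullQhat (DSq n i j). dist (invs z) w \<le> deltaQ (DSq n i j)"
proof -
  define Q s x0 y0 where "Q = DSq n i j" and "s = side n" and "x0 = -2 + s * i" and "y0 = -2 + s * j"
  define x1 y1 where "x1 = x0 + s" and "y1 = y0 + s"
  have s: "0 < s" "s \<le> 1/2" using valid side_pos[of n] by (simp_all add: s_def valid_obj_def)
  have box: "-3/2 \<le> x0" "x1 \<le> 3/2" "-3/2 \<le> y0" "y1 \<le> 3/2"
    using valid by (simp_all add: valid_obj_def x0_def y0_def x1_def y1_def s_def algebra_simps)
  have vR: "vertsR Q 1 = (x0, y0)" "vertsR Q 2 = (x1, y0)" "vertsR Q 3 = (x1, y1)" "vertsR Q 4 = (x0, y1)"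
    by (simp_all add: Q_def x0_def y0_def x1_def y1_def s_def Let_def)
  have v: "verts Q 1 = Fin (x0, y0)" "verts Q 2 = Fin (x1, y0)" "verts Q 3 = Fin (x1, y1)" "verts Q 4 = Fin (x0, y1)"
    using vR by (simp_all add: verts_def Q_def del: vertsR.simps)
  have vs: "vsetR Q = {(x0, y0), (x1, y0), (x1, y1), (x0, y1)}"
    unfolding vsetR_def one_to_four by (simp only: image_insert image_empty vR)
  have "convex hull vsetR Q \<subseteq> {x0..x1} \<times> {y0..y1}"
    using s unfolding vs by (intro hull_minimal convex_Times) (auto simp: x1_def y1_def)
  then obtain x y where xy: "z = Fin (x, y)" "x0 \<le> x" "x \<le> x1" "y0 \<le> y" "y \<le> y1"
    using assms(2) by (auto simp: hullQ_def Q_def)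
  have edge: ?thesis
    if k: "k \<in> {1..4}" "l \<in> {1..4}" and d: "dist (invs (verts Q k)) (invs (verts Q l)) \<le> d1Q Q"
      and w: "\<exists>w\<in>closed_segment (invs (verts Q k)) (invs (verts Q l)).
        dist (invs z) w \<le> chi 1 (dist (invs (verts Q k)) (invs (verts Q l)))" for k l
  proof -
    have "closed_segment (invs (verts Q k)) (invs (verts Q l)) \<subseteq> hullQhat Q"
      unfolding hullQhat_def segment_convex_hull using k by (intro hull_mono) auto
    moreover have "chi 1 (dist (invs (verts Q k)) (invs (verts Q l))) \<le> deltaQ Q"
      using chi_mono[OF _ _ d, of 1] by (simp add: deltaQ_def Q_def)
    ultimately show ?thesis using w unfolding Q_def by (meson order_trans subsetD)
  qed
  have d1: "dist (invs (verts Q 1)) (invs (verts Q 4)) \<le> d1Q Q"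
     "dist (invs (verts Q 2)) (invs (verts Q 3)) \<le> d1Q Q"
     "dist (invs (verts Q 1)) (invs (verts Q 2)) \<le> d1Q Q"
     "dist (invs (verts Q 4)) (invs (verts Q 3)) \<le> d1Q Q"
    unfolding d1Q_def by (auto intro!: Max_ge simp: dist_commute)
  \<comment> \<open>Goodness of the square puts the sides within 3/2 of the axes, and 9/4 is below
    the 3 demanded by the edge lemmas.\<close>
  have sq_le: "X\<^sup>2 \<le> 3" if "-3/2 \<le> X" "X \<le> 3/2" for X :: real
  proof -
    have "X\<^sup>2 \<le> (3/2)\<^sup>2" using that by (intro abs_le_square_iff[THEN iffD1]) auto
    then show ?thesis by (simp add: power2_eq_square)
  qed
  \<comment> \<open>The product is negative only when the interval straddles 0, and then it is at
    least \<open>- s\<^sup>2 / 4\<close>. With \<open>s \<le> 1/2\<close> this keeps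
    \<open>M\<close> positive and supplies the sign conditions of the edge lemmas.\<close>
  have prod_ge: "- (1/16) \<le> t * (t + s)" for t
  proof -
    have "t * (t + s) = (t + s / 2)\<^sup>2 - s\<^sup>2 / 4" by (simp add: power2_eq_square algebra_simps)
    moreover have "s\<^sup>2 \<le> 1/4" using s power_mono[of s "1/2" 2] by (simp add: power_divide)
    moreover have "0 \<le> (t + s / 2)\<^sup>2" by simp
    ultimately show ?thesis by linarith
  qed
  have xx: "- (1/16) \<le> x0 * x1" and yy: "- (1/16) \<le> y0 * y1"
    unfolding x1_def y1_def by (rule prod_ge)+
  define M \<kappa> where "M = 1 + x0 * x1 + y0 * y1" and "\<kappa> = (x - x0) * (x1 - x) + (y - y0) * (y1 - y)"
  have M: "M > 0" using xx yy by (simp add: M_def)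
  have \<kappa>: "\<kappa> \<ge> 0" using xy by (simp add: \<kappa>_def)
  have pos: "0 \<le> 1 + X\<^sup>2 + t" if "- (1/16) \<le> t" for X t :: real
    using that zero_le_power2[of X] by linarith
  consider "\<kappa> * x0 \<le> (x - x0) * M" "- \<kappa> * x1 \<le> (x1 - x) * M" "\<kappa> * y0 \<le> (y - y0) * M" "- \<kappa> * y1 \<le> (y1 - y) * M"
    | "(x - x0) * M < \<kappa> * x0" | "(x1 - x) * M < - \<kappa> * x1"
    | "(y - y0) * M < \<kappa> * y0" | "(y1 - y) * M < - \<kappa> * y1"
    by linarith
  then show ?thesis
  proof cases
    case 1
    obtain m1 m2 m3 m4 where m: "0 \<le> m1" "0 \<le> m2" "0 \<le> m3" "0 \<le> m4"
      "invs (Fin (x, y)) = m1 *\<^sub>R invs (Fin (x0, y0)) + m2 *\<^sub>R invs (Fin (x1, y0)) +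
        m3 *\<^sub>R invs (Fin (x1, y1)) + m4 *\<^sub>R invs (Fin (x0, y1))"
      by (rule square_cone[OF s(1) x1_def y1_def M[unfolded M_def] \<kappa>[unfolded \<kappa>_def] 1[unfolded M_def \<kappa>_def]])
    define m where "m k = (if k = 1 then m1 else if k = 2 then m2 else if k = 3 then m3 else m4)" for k :: nat
    have "invs z = (\<Sum>k=1..4. m k *\<^sub>R invs (verts Q k))"
      unfolding one_to_four xy(1) m(5) by (simp add: m_def v v(1)[unfolded One_nat_def] del: invs.simps)
    moreover have "sqrt (s\<^sup>2 + s\<^sup>2) = 2 * sqrt (s\<^sup>2 / 2)"
      by (rule real_sqrt_unique) (simp_all add: power_mult_distrib)
    moreover have "sqrt ((s / 2)\<^sup>2 + (s / 2)\<^sup>2) = sqrt (s\<^sup>2 / 2)"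
      by (simp add: power_divide)
    moreover from calculation have sph: "vsetR Q \<subseteq> sphere (x0 + s / 2, y0 + s / 2) (sqrt (s\<^sup>2 / 2))"
      unfolding vs by (auto simp: dist_Pair_Pair dist_real_def x1_def y1_def power2_eq_square field_simps)
    moreover have "DQ Q = cball (x0 + s / 2, y0 + s / 2) (sqrt (s\<^sup>2 / 2))"
      using calculation by (intro DQ_eq_cball[of "(x0, y0)" _ "(x1, y1)"])
        (auto simp: vs dist_Pair_Pair dist_real_def x1_def y1_def)
    moreover have "0 \<le> m k" for k using m by (simp add: m_def)
    ultimately have "\<exists>w\<in>hullQhat Q. dist (invs z) w \<le> chi 2 (d2Q Q)"
      by (intro circle_radial_approx) (auto simp: Q_def)
    then show ?thesis by (force simp: Q_def deltaQ_def)
  next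
    case 2
    have x0: "x0 > 0"
    proof (rule ccontr)
      assume "\<not> x0 > 0"
      then have "\<kappa> * x0 \<le> 0" using \<kappa> by (simp add: mult_nonneg_nonpos)
      moreover have "0 \<le> (x - x0) * M" using xy M by simp
      ultimately show False using 2 by linarith
    qed
    \<comment> \<open>With \<open>\<kappa>\<close>, \<open>M\<close> and \<open>x - x0\<close>
      nonnegative, the failure forces \<open>x0 > 0\<close>. Divided by \<open>x0\<close>, the
      failed inequality becomes hypothesis \<open>nonneg\<close> of
      \<open>vertical_edge_approx\<close>. The remaining three cases follow the same
      pattern.\<close>
    have "0 < \<kappa> * x0 - (x - x0) * M" using 2 by simp
    also have "\<dots> = x0 * (x * (x0 - x) + (y - y0) * (y1 - y) - (x / x0 - 1) * (1 + y0 * y1))"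
      using x0 by (simp add: \<kappa>_def M_def field_simps)
    finally have "0 \<le> x * (x0 - x) + (y - y0) * (y1 - y) - (x / x0 - 1) * (1 + y0 * y1)"
      using x0 by (simp add: zero_less_mult_iff)
    then show ?thesis
      using edge[of 1 4] vertical_edge_approx[of x0 x y0 y1 y] d1 x0 xy s box sq_le[of x0] pos[OF yy]
      by (simp add: v v(1)[unfolded One_nat_def] y1_def x1_def del: invs.simps)
  next
    case 3
    have x1: "x1 < 0"
    proof (rule ccontr)
      assume "\<not> x1 < 0"
      then have "- \<kappa> * x1 \<le> 0" using \<kappa> by simp
      moreover have "0 \<le> (x1 - x) * M" using xy M by simp
      ultimately show False using 3 by linarith
    qed
    have "0 > \<kappa> * x1 + (x1 - x) * M" using 3 by simp
    also have "\<kappa> * x1 + (x1 - x) * M = x1 * (x * (x1 - x) + (y - y0) * (y1 - y) - (x / x1 - 1) * (1 + y0 * y1))"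
      using x1 by (simp add: \<kappa>_def M_def field_simps)
    finally have "0 \<le> x * (x1 - x) + (y - y0) * (y1 - y) - (x / x1 - 1) * (1 + y0 * y1)"
      using x1 by (simp add: mult_less_0_iff)
    moreover have "1 \<le> x / x1" using x1 xy by (simp add: le_divide_eq)
    ultimately show ?thesis
      using edge[of 2 3] vertical_edge_approx[of x1 x y0 y1 y] d1 x1 xy s box sq_le[of x1] pos[OF yy]
      by (simp add: v v(1)[unfolded One_nat_def] y1_def x1_def del: invs.simps)
  next
    case 4
    have y0: "y0 > 0"
    proof (rule ccontr)
      assume "\<not> y0 > 0"
      then have "\<kappa> * y0 \<le> 0" using \<kappa> by (simp add: mult_nonneg_nonpos)
      moreover have "0 \<le> (y - y0) * M" using xy M by simp
      ultimately show False using 4 by linarith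
    qed
    have "0 < \<kappa> * y0 - (y - y0) * M" using 4 by simp
    also have "\<dots> = y0 * (y * (y0 - y) + (x - x0) * (x1 - x) - (y / y0 - 1) * (1 + x0 * x1))"
      using y0 by (simp add: \<kappa>_def M_def field_simps)
    finally have "0 \<le> y * (y0 - y) + (x - x0) * (x1 - x) - (y / y0 - 1) * (1 + x0 * x1)"
      using y0 by (simp add: zero_less_mult_iff)
    then show ?thesis
      using edge[of 1 2] horizontal_edge_approx[of y0 y x0 x1 x] d1 y0 xy s box sq_le[of y0] pos[OF xx]
      by (simp add: v v(1)[unfolded One_nat_def] y1_def x1_def del: invs.simps)
  next
    case 5
    have y1: "y1 < 0"
    proof (rule ccontr)
      assume "\<not> y1 < 0"
      then have "- \<kappa> * y1 \<le> 0" using \<kappa> by simp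
      moreover have "0 \<le> (y1 - y) * M" using xy M by simp
      ultimately show False using 5 by linarith
    qed
    have "0 > \<kappa> * y1 + (y1 - y) * M" using 5 by simp
    also have "\<kappa> * y1 + (y1 - y) * M = y1 * (y * (y1 - y) + (x - x0) * (x1 - x) - (y / y1 - 1) * (1 + x0 * x1))"
      using y1 by (simp add: \<kappa>_def M_def field_simps)
    finally have "0 \<le> y * (y1 - y) + (x - x0) * (x1 - x) - (y / y1 - 1) * (1 + x0 * x1)"
      using y1 by (simp add: mult_less_0_iff)
    moreover have "1 \<le> y / y1" using y1 xy by (simp add: le_divide_eq)
    ultimately show ?thesis
      using edge[of 4 3] horizontal_edge_approx[of y1 y x0 x1 x] d1 y1 xy s box sq_le[of y1] pos[OF xx]
      by (simp add: v v(1)[unfolded One_nat_def] y1_def x1_def del: invs.simps)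
  qed
qed

lemma hull_approx:
  assumes "valid_obj Q" "z \<in> hullQ Q"
  shows "\<exists>w\<in>hullQhat Q. dist (invs z) w \<le> deltaQ Q"
proof (cases Q)
  case (DSeg n j)
  then show ?thesis using segment_hull_approx assms by (simp add: deltaQ_def)
next
  case (DSq n i j)
  then show ?thesis using square_hull_approx assms by blast
next
  case DInf
  then have "z = Infty" "hullQhat Q = {invs Infty}"
    using assms(2) by (auto simp: hullQ_def hullQhat_def verts_def image_constant_conv)
  then show ?thesis by (simp add: DInf deltaQ_def)
qed

section \<open>Energy estimates\<close>

lemma powr_above_tangent:
  fixes s t k :: real
  assumes "1 \<le> k" "0 \<le> s" "0 \<le> t"
  shows "s powr k + k * s powr (k - 1) * (t - s) \<le> t powr k"
\<comment> \<open>The derivative rules need a positive base, so zero arguments are treated apart.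
  Since \<open>0 powr (k - 1) = 0\<close> even for \<open>k = 1\<close>, the case
  \<open>s = 0\<close> is immediate.\<close>
proof (cases "s = 0 \<or> t = 0")
  case True
  then show ?thesis
  proof
    assume "t = 0"
    have "s powr (k - 1) * s = s powr k" using powr_mult_base[OF \<open>0 \<le> s\<close>, of "k - 1"] by (simp add: mult.commute)
    then have "s powr k + k * s powr (k - 1) * (t - s) = (1 - k) * s powr k"
      using \<open>t = 0\<close> by (simp add: algebra_simps)
    also have "\<dots> \<le> 0" using \<open>1 \<le> k\<close> by (simp add: mult_nonpos_nonneg)
    finally show ?thesis using \<open>t = 0\<close> by simp
  qed simp
next
  case False
  then have "s > 0" "t > 0" using assms by auto
  moreover have "((\<lambda>x. x powr k) has_real_derivative k * x powr (k - 1)) (at x)" if "x \<in> {0<..}" for x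
    using that by (auto intro!: derivative_eq_intros)
  moreover have "((\<lambda>x. k * x powr (k - 1)) has_real_derivative k * ((k - 1) * x powr (k - 2))) (at x)"
    if "x \<in> {0<..}" for x
    using that by (auto intro!: derivative_eq_intros)
  ultimately have "k * s powr (k - 1) * (t - s) \<le> t powr k - s powr k"
    using \<open>1 \<le> k\<close> by (intro f''_imp_f'[of "{0<..}" _ _ "\<lambda>x. k * ((k - 1) * x powr (k - 2))"]) auto
  then show ?thesis by simp
qed

text \<open>On \<open>{0<..T}\<close> the function \<open>C / 2 * x\<^sup>2 - x powr k\<close> is
  convex, because for \<open>k \<ge> 2\<close> the second derivative of the power is largest at
  \<open>T\<close>. The claim is its tangent inequality at \<open>s\<close>.\<close>

lemma powr_below_parabola:
  fixes s t k T :: real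
  assumes "2 \<le> k" "0 \<le> s" "s \<le> T" "0 \<le> t" "t \<le> T"
  shows "t powr k \<le> s powr k + k * s powr (k - 1) * (t - s) + 1/2 * k * (k - 1) * T powr (k - 2) * (t - s)\<^sup>2"
proof -
  define C where "C = k * (k - 1) * T powr (k - 2)"
  \<comment> \<open>At a zero argument the claim reduces to this bound, together with
    \<open>k * (k - 1) / 2\<close> being at least 1 (for \<open>s = 0\<close>) or at least
    \<open>k - 1\<close> (for \<open>t = 0\<close>).\<close>
  have base: "x powr k \<le> T powr (k - 2) * x\<^sup>2" if "0 \<le> x" "x \<le> T" for x
  proof -
    have "x powr k = x powr (k - 2) * x\<^sup>2"
      using that powr_add[of x "k - 2" 2] by (cases "x = 0") (auto simp: powr_numeral)
    also have "\<dots> \<le> T powr (k - 2) * x\<^sup>2"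
      using that \<open>2 \<le> k\<close> by (intro mult_right_mono powr_mono2) auto
    finally show ?thesis .
  qed
  have "t powr k \<le> s powr k + k * s powr (k - 1) * (t - s) + C / 2 * (t - s)\<^sup>2"
  proof (cases "s = 0 \<or> t = 0")
    case True
    then show ?thesis
    proof
      assume s: "s = 0"
      have "2 * 1 \<le> k * (k - 1)" using \<open>2 \<le> k\<close> by (intro mult_mono) auto
      then have "1 * (T powr (k - 2) * t\<^sup>2) \<le> (k * (k - 1) / 2) * (T powr (k - 2) * t\<^sup>2)"
        by (intro mult_right_mono) auto
      then show ?thesis using base[of t] assms s by (simp add: C_def)
    next
      assume t: "t = 0"
      have "s powr (k - 1) * s = s powr k" using powr_mult_base[OF \<open>0 \<le> s\<close>, of "k - 1"] by (simp add: mult.commute)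
      then have "k * s powr (k - 1) * (t - s) = - (k * s powr k)" by (simp add: t mult.assoc)
      moreover have "(k - 1) * s powr k \<le> (k * (k - 1) / 2) * (T powr (k - 2) * s\<^sup>2)"
      proof (intro mult_mono)
        have "2 * (k - 1) \<le> k * (k - 1)" using \<open>2 \<le> k\<close> by (intro mult_right_mono) auto
        then show "k - 1 \<le> k * (k - 1) / 2" by simp
      qed (use \<open>2 \<le> k\<close> base[of s] assms in auto)
      then have "k * s powr k - s powr k \<le> C / 2 * s\<^sup>2" by (simp add: C_def algebra_simps)
      moreover have "C / 2 * (t - s)\<^sup>2 = C / 2 * s\<^sup>2" "t powr k = 0" using t by simp_all
      ultimately show ?thesis by linarith
    qed
  next
    case False
    then have st: "s \<in> {0<..T}" "t \<in> {0<..T}" using assms by auto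
    have "(C * s - k * s powr (k - 1)) * (t - s) \<le> (C / 2 * t\<^sup>2 - t powr k) - (C / 2 * s\<^sup>2 - s powr k)"
    proof (rule f''_imp_f'[OF _ _ _ _ st])
      fix x assume x: "x \<in> {0<..T}"
      show "((\<lambda>x. C / 2 * x\<^sup>2 - x powr k) has_real_derivative C * x - k * x powr (k - 1)) (at x)"
        using x by (auto intro!: derivative_eq_intros)
      show "((\<lambda>x. C * x - k * x powr (k - 1)) has_real_derivative C - k * ((k - 1) * x powr (k - 2))) (at x)"
        using x by (auto intro!: derivative_eq_intros)
      have "k * (k - 1) * x powr (k - 2) \<le> C"
        unfolding C_def using x \<open>2 \<le> k\<close> by (intro mult_left_mono powr_mono2) auto
      then show "0 \<le> C - k * ((k - 1) * x powr (k - 2))" by (simp add: mult.assoc)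
    qed auto
    then show ?thesis by (simp add: power2_eq_square algebra_simps)
  qed
  then show ?thesis by (simp add: C_def)
qed

text \<open>Averaging \<open>powr_below_parabola\<close> at the mean \<open>s\<close> kills the
  linear term and leaves the weighted variance. Values spread over at most \<open>2 * d\<close> have
  variance at most \<open>d\<^sup>2\<close> (Popoviciu's inequality).\<close>

lemma weighted_powr_le:
  fixes \<mu> t :: "'i \<Rightarrow> real"
  assumes "2 \<le> k" "finite S" and \<mu>: "\<And>i. i \<in> S \<Longrightarrow> 0 \<le> \<mu> i" "sum \<mu> S = 1"
    and t: "\<And>i. i \<in> S \<Longrightarrow> 0 \<le> t i" "\<And>i. i \<in> S \<Longrightarrow> t i \<le> T"
    and d: "\<And>i j. i \<in> S \<Longrightarrow> j \<in> S \<Longrightarrow> t i - t j \<le> 2 * d"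
  shows "(\<Sum>i\<in>S. \<mu> i * t i powr k) \<le> (\<Sum>i\<in>S. \<mu> i * t i) powr k + 1/2 * k * (k - 1) * T powr (k - 2) * d\<^sup>2"
proof -
  define s C where "s = (\<Sum>i\<in>S. \<mu> i * t i)" and "C = 1/2 * k * (k - 1) * T powr (k - 2)"
  have s: "0 \<le> s" unfolding s_def using \<mu> t by (intro sum_nonneg) auto
  have "s \<le> (\<Sum>i\<in>S. \<mu> i * T)" unfolding s_def using \<mu> t by (intro sum_mono mult_left_mono) auto
  then have sT: "s \<le> T" using \<mu>(2) by (simp flip: sum_distrib_right)
  have "S \<noteq> {}" using \<mu>(2) by auto
  define c where "c = (Max (t ` S) + Min (t ` S)) / 2"
  have "Max (t ` S) \<in> t ` S" "Min (t ` S) \<in> t ` S"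
    using \<open>finite S\<close> \<open>S \<noteq> {}\<close> by (intro Max_in Min_in; simp)+
  then have range: "Max (t ` S) - Min (t ` S) \<le> 2 * d" using d by auto
  have c: "(t i - c)\<^sup>2 \<le> d\<^sup>2" if "i \<in> S" for i
  proof -
    have "Min (t ` S) \<le> t i" "t i \<le> Max (t ` S)" using that \<open>finite S\<close> by auto
    then have "\<bar>t i - c\<bar> \<le> \<bar>d\<bar>" using range unfolding c_def by (simp add: abs_le_iff field_simps)
    then show ?thesis by (simp add: abs_le_square_iff)
  qed
  \<comment> \<open>The second moment about the midrange \<open>c\<close> exceeds the variance by
    \<open>(s - c)\<^sup>2\<close>, and every value is within \<open>d\<close> of
    \<open>c\<close>.\<close>
  have "(\<Sum>i\<in>S. \<mu> i * (t i - s)\<^sup>2) = (\<Sum>i\<in>S. \<mu> i * (t i - c)\<^sup>2 - 2 * (s - c) * (\<mu> i * t i) + \<mu> i * (s\<^sup>2 - c\<^sup>2))"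
    by (intro sum.cong) (auto simp: power2_eq_square algebra_simps)
  also have "\<dots> = (\<Sum>i\<in>S. \<mu> i * (t i - c)\<^sup>2) - 2 * (s - c) * s + (s\<^sup>2 - c\<^sup>2)"
    using \<mu>(2) by (simp add: sum.distrib sum_subtractf s_def flip: sum_distrib_left sum_distrib_right)
  also have "\<dots> = (\<Sum>i\<in>S. \<mu> i * (t i - c)\<^sup>2) - (s - c)\<^sup>2" by (simp add: power2_eq_square algebra_simps)
  also have "\<dots> \<le> (\<Sum>i\<in>S. \<mu> i * d\<^sup>2)"
  proof -
    have "(\<Sum>i\<in>S. \<mu> i * (t i - c)\<^sup>2) \<le> (\<Sum>i\<in>S. \<mu> i * d\<^sup>2)" using \<mu> c by (intro sum_mono mult_left_mono) auto
    then show ?thesis by (smt (verit) zero_le_power2)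
  qed
  also have "\<dots> = d\<^sup>2" using \<mu>(2) by (simp flip: sum_distrib_right)
  finally have var: "(\<Sum>i\<in>S. \<mu> i * (t i - s)\<^sup>2) \<le> d\<^sup>2" .
  have C: "0 \<le> C" using \<open>2 \<le> k\<close> by (simp add: C_def)
  have "(\<Sum>i\<in>S. \<mu> i * t i powr k) \<le> (\<Sum>i\<in>S. \<mu> i * (s powr k + k * s powr (k - 1) * (t i - s) + C * (t i - s)\<^sup>2))"
    unfolding C_def using \<mu> t s sT \<open>2 \<le> k\<close> by (intro sum_mono mult_left_mono powr_below_parabola) auto
  also have "\<dots> = (\<Sum>i\<in>S. \<mu> i * (s powr k - k * s powr (k - 1) * s) + k * s powr (k - 1) * (\<mu> i * t i) + C * (\<mu> i * (t i - s)\<^sup>2))"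
    by (intro sum.cong) (auto simp: algebra_simps)
  also have "\<dots> = s powr k + C * (\<Sum>i\<in>S. \<mu> i * (t i - s)\<^sup>2)"
    using \<mu>(2) by (simp add: sum.distrib s_def flip: sum_distrib_left sum_distrib_right)
  also have "\<dots> \<le> s powr k + C * d\<^sup>2" using var C by (intro add_left_mono mult_left_mono) auto
  finally show ?thesis by (simp add: s_def C_def)
qed

section \<open>Replacing points by weighted vertices\<close>

lemma Gk_inner: "Gk k p q = (2 + 2 * (invs p \<bullet> invs q)) powr k"
proof -
  have "(norm (invs p - invs q))\<^sup>2 = 2 - 2 * (invs p \<bullet> invs q)"
    by (simp add: power2_norm_eq_inner inner_diff_left inner_diff_right inner_commute)
       (simp add: dot_square_norm)
  then show ?thesis by (simp add: Gk_def)
qed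

lemma Gk_commute: "Gk k p q = Gk k q p"
  by (simp add: Gk_inner inner_commute)

lemma deltaQ_nonneg: "0 \<le> deltaQ Q"
  by (cases Q) (auto simp: deltaQ_def chi_nonneg le_max_iff_disj)

lemma verts_in_hullQ: "i \<in> {1..4} \<Longrightarrow> verts Q i \<in> hullQ Q"
  by (auto simp: hullQ_def verts_def vsetR_def intro!: imageI hull_inc)

text \<open>A linear functional on \<open>hullQhat Q'\<close> is bounded by its maximum over the
  lifted vertices, and \<open>invs w\<close> is within \<open>deltaQ Q'\<close> of that hull, an
  error that \<open>dotmax\<close> absorbs. This is what makes \<open>T\<close> an upper bound for
  the bases of the powers.\<close>

lemma inner_le_dotmax:
  assumes "Q \<noteq> DInf" "i \<in> {1..4}" "valid_obj Q'" "w \<in> hullQ Q'"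
  shows "invs (verts Q i) \<bullet> invs w \<le> dotmax Q Q'"
proof (cases "Q' = DInf")
  case True
  then have "w = Infty" using assms(4) by (simp add: hullQ_def)
  then show ?thesis using True assms(2) by (auto simp: dotmax_def intro!: Max_ge)
next
  case False
  define q where "q = invs (verts Q i)"
  define Mx where "Mx = Max ((\<lambda>(i, j). invs (verts Q i) \<bullet> invs (verts Q' j)) ` ({1..4} \<times> {1..4}))"
  obtain v where v: "v \<in> hullQhat Q'" "dist (invs w) v \<le> deltaQ Q'"
    using hull_approx assms(3,4) by blast
  have "q \<bullet> invs (verts Q' j) \<le> Mx" if "j \<in> {1..4}" for j
    unfolding Mx_def q_def using that assms(2) by (intro Max_ge) (auto intro!: image_eqI[of _ _ "(i, j)"])
  then have "hullQhat Q' \<subseteq> {x. q \<bullet> x \<le> Mx}"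
    unfolding hullQhat_def by (intro hull_minimal convex_halfspace_le) auto
  then have "q \<bullet> v \<le> Mx" using v by blast
  moreover have "q \<bullet> (invs w - v) \<le> norm q * norm (invs w - v)" by (rule norm_cauchy_schwarz)
  then have "q \<bullet> invs w \<le> q \<bullet> v + deltaQ Q'"
    using v(2) by (simp add: q_def dist_norm inner_diff_right)
  moreover have "0 \<le> deltaQ Q * deltaQ Q'" by (simp add: deltaQ_nonneg)
  ultimately show ?thesis using False deltaQ_nonneg[of Q] by (simp add: dotmax_def q_def Mx_def)
qed

text \<open>The closest-point clause turns the existence statement \<open>hull_approx\<close> into a
  bound for the fixed combination itself.\<close>

lemma weighting_systemD:
  assumes "weighting_system lam" "valid_obj Q" "z \<in> hullQ Q"
  shows "i \<in> {1..4} \<Longrightarrow> 0 \<le> lam Q z i" and "(\<Sum>i=1..4. lam Q z i) = 1"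
    and "dist (invs z) (\<Sum>i=1..4. lam Q z i *\<^sub>R invs (verts Q i)) \<le> deltaQ Q"
proof -
  define zs where "zs = (\<Sum>i=1..4. lam Q z i *\<^sub>R invs (verts Q i))"
  have *: "(\<forall>i\<in>{1..4}. 0 \<le> lam Q z i) \<and> (\<Sum>i=1..4. lam Q z i) = 1 \<and>
      (zs \<in> hullQhat Q \<and> (\<forall>w\<in>hullQhat Q. dist (invs z) zs \<le> dist (invs z) w))"
    using assms unfolding weighting_system_def Let_def zs_def by blast
  then show "i \<in> {1..4} \<Longrightarrow> 0 \<le> lam Q z i" "(\<Sum>i=1..4. lam Q z i) = 1" by blast+
  obtain w where "w \<in> hullQhat Q" "dist (invs z) w \<le> deltaQ Q"
    using hull_approx assms by blast
  then show "dist (invs z) (\<Sum>i=1..4. lam Q z i *\<^sub>R invs (verts Q i)) \<le> deltaQ Q"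
    using * unfolding zs_def by (meson order_trans)
qed

text \<open>The two terms of \<open>epsQ\<close> belong to two moves. Passing from the vertices to
  the point \<open>zs\<close> of the hull costs the variance term by
  \<open>weighted_powr_le\<close>; passing from \<open>zs\<close> to \<open>invs z\<close> costs the
  first-order term by the tangent at \<open>s\<close>.\<close>

lemma Gk_single_replacement:
  assumes "2 \<le> k" "weighting_system lam" "valid_obj Q" "z \<in> hullQ Q" "valid_obj Q'" "w \<in> hullQ Q'"
  shows "(\<Sum>i=1..4. lam Q z i * Gk k (verts Q i) w) - epsQ k Q Q' \<le> Gk k z w"
proof (cases "Q = DInf")
  case True
  then have "z = Infty" "\<And>i. verts Q i = Infty" using assms(4) by (simp_all add: hullQ_def verts_def)
  then show ?thesis using weighting_systemD(2)[OF assms(2-4)]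
    by (simp add: epsQ_def True flip: sum_distrib_right)
next
  case False
  note lam = weighting_systemD[OF assms(2-4)]
  define T where "T = 2 + 2 * dotmax Q Q'"
  define t where "t i = 2 + 2 * (invs (verts Q i) \<bullet> invs w)" for i
  define zs where "zs = (\<Sum>i=1..4. lam Q z i *\<^sub>R invs (verts Q i))"
  define s where "s = (\<Sum>i=1..4. lam Q z i * t i)"
  have nonneg: "0 \<le> 2 + 2 * (invs p \<bullet> invs w)" for p
    using Cauchy_Schwarz_ineq2[of "invs p" "invs w"] by simp
  have tT: "t i \<le> T" if "i \<in> {1..4}" for i
    using inner_le_dotmax[OF False that assms(5,6)] by (simp add: t_def T_def)
  have bdd: "bounded (hullQhat Q)"
    unfolding hullQhat_def by (intro bounded_convex_hull finite_imp_bounded) auto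
  \<comment> \<open>The base \<open>2 + 2 * (p \<bullet> q)\<close> has slope 2, hence the spread
    \<open>2 * dQ Q\<close>, which fits the factor 2 in \<open>weighted_powr_le\<close>.\<close>
  have td: "t i - t j \<le> 2 * dQ Q" if "i \<in> {1..4}" "j \<in> {1..4}" for i j
  proof -
    have "(invs (verts Q i) - invs (verts Q j)) \<bullet> invs w \<le> dist (invs (verts Q i)) (invs (verts Q j))"
      using norm_cauchy_schwarz[of "invs (verts Q i) - invs (verts Q j)" "invs w"] by (simp add: dist_norm)
    also have "\<dots> \<le> dQ Q" unfolding dQ_def using False that bdd
      by (auto intro!: diameter_bounded_bound simp: hullQhat_def hull_inc)
    finally show ?thesis by (simp add: t_def inner_diff_left)
  qed
  have "s = (\<Sum>i=1..4. 2 * lam Q z i + 2 * (lam Q z i * (invs (verts Q i) \<bullet> invs w)))"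
    unfolding s_def t_def by (intro sum.cong) (auto simp: algebra_simps)
  also have "\<dots> = 2 + 2 * (zs \<bullet> invs w)"
    using lam(2) by (simp add: sum.distrib zs_def inner_sum_left flip: sum_distrib_left)
  finally have s: "s = 2 + 2 * (zs \<bullet> invs w)" .
  have s0: "0 \<le> s" unfolding s_def using lam(1) nonneg by (intro sum_nonneg mult_nonneg_nonneg) (auto simp: t_def)
  have "s \<le> (\<Sum>i=1..4. lam Q z i * T)" unfolding s_def using lam(1) tT by (intro sum_mono mult_left_mono) auto
  then have sT: "s \<le> T" using lam(2) by (simp flip: sum_distrib_right)
  define u where "u = 2 + 2 * (invs z \<bullet> invs w)"
  have "(zs - invs z) \<bullet> invs w \<le> norm (zs - invs z) * norm (invs w)" by (rule norm_cauchy_schwarz)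
  then have su: "s - u \<le> 2 * deltaQ Q"
    using lam(3) by (simp add: s u_def inner_diff_left dist_norm norm_minus_commute zs_def)
  have "(\<Sum>i=1..4. lam Q z i * t i powr k) \<le> s powr k + 1/2 * k * (k - 1) * T powr (k - 2) * (dQ Q)\<^sup>2"
    unfolding s_def by (rule weighted_powr_le) (use assms(1) lam tT td nonneg in \<open>auto simp: t_def\<close>)
  moreover have "s powr k \<le> u powr k + 2 * k * T powr (k - 1) * deltaQ Q"
  proof -
    have "s powr k \<le> u powr k + k * s powr (k - 1) * (s - u)"
      using powr_above_tangent[of k s u] assms(1) s0 nonneg[of z] by (simp add: u_def algebra_simps)
    also have "k * s powr (k - 1) * (s - u) \<le> k * s powr (k - 1) * (2 * deltaQ Q)"
      using su assms(1) by (intro mult_left_mono) auto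
    also have "\<dots> \<le> k * T powr (k - 1) * (2 * deltaQ Q)"
      using s0 sT assms(1) deltaQ_nonneg[of Q] by (intro mult_right_mono mult_left_mono powr_mono2) auto
    finally show ?thesis by (simp add: mult_ac)
  qed
  ultimately show ?thesis
    using False by (simp add: epsQ_def Gk_inner t_def u_def T_def Let_def)
qed

text \<open>The first point is replaced with the second held at \<open>w\<close>; then
  \<open>w\<close> is replaced with each vertex of \<open>Q\<close> in the other slot. The weights
  of \<open>Q\<close> sum to 1, so the second error is counted once.\<close>

lemma Gk_pair_replacement:
  assumes "2 \<le> k" "weighting_system lam" "valid_obj Q" "z \<in> hullQ Q" "valid_obj Q'" "w \<in> hullQ Q'"
  shows "(\<Sum>i=1..4. \<Sum>j=1..4. lam Q z i * lam Q' w j * Gk k (verts Q i) (verts Q' j))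
      - (epsQ k Q Q' + epsQ k Q' Q) \<le> Gk k z w"
proof -
  note lam = weighting_systemD[OF assms(2-4)]
  have step: "(\<Sum>j=1..4. lam Q' w j * Gk k (verts Q i) (verts Q' j)) - epsQ k Q' Q \<le> Gk k (verts Q i) w"
    if "i \<in> {1..4}" for i
    using Gk_single_replacement[OF assms(1,2,5,6,3) verts_in_hullQ[OF that]] by (simp add: Gk_commute)
  have "(\<Sum>i=1..4. \<Sum>j=1..4. lam Q z i * lam Q' w j * Gk k (verts Q i) (verts Q' j)) - epsQ k Q' Q
      = (\<Sum>i=1..4. lam Q z i * ((\<Sum>j=1..4. lam Q' w j * Gk k (verts Q i) (verts Q' j)) - epsQ k Q' Q))"
    using lam(2) by (simp add: right_diff_distrib sum_subtractf sum_distrib_left mult.assoc flip: sum_distrib_right)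
  also have "\<dots> \<le> (\<Sum>i=1..4. lam Q z i * Gk k (verts Q i) w)"
    using lam(1) step by (intro sum_mono mult_left_mono) auto
  finally show ?thesis using Gk_single_replacement[OF assms] by linarith
qed

section \<open>Summation over multi-indices\<close>

lemma sum_PiE_two_marginals:
  fixes \<mu> :: "'a \<Rightarrow> 'b \<Rightarrow> real"
  assumes "finite A" "finite B" "a \<in> A" "b \<in> A" "a \<noteq> b" and one: "\<And>c. c \<in> A \<Longrightarrow> (\<Sum>i\<in>B. \<mu> c i) = 1"
  shows "(\<Sum>I\<in>PiE A (\<lambda>_. B). (\<Prod>c\<in>A. \<mu> c (I c)) * F (I a) (I b))
    = (\<Sum>i\<in>B. \<Sum>j\<in>B. \<mu> a i * \<mu> b j * F i j)"
proof -
  \<comment> \<open>\<open>g i j\<close> is the weight times the indicator of \<open>I a = i\<close>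
    and \<open>I b = j\<close>, put into the factors \<open>a\<close> and \<open>b\<close>. The
    restricted sum of products thus stays a product of sums, where every other coordinate
    contributes 1.\<close>
  define g where "g i j c y = (if c = a \<and> y \<noteq> i \<or> c = b \<and> y \<noteq> j then 0 else \<mu> c y)" for i j c y
  have g: "(\<Prod>c\<in>A. g i j c (I c)) = (if I a = i \<and> I b = j then (\<Prod>c\<in>A. \<mu> c (I c)) else 0)" for I i j
  proof (cases "I a = i \<and> I b = j")
    case True
    then show ?thesis by (auto simp: g_def intro!: prod.cong)
  next
    case False
    then have "\<exists>c\<in>A. g i j c (I c) = 0" using assms(3,4) by (auto simp: g_def)
    then show ?thesis using False \<open>finite A\<close> by (auto intro: prod_zero)
  qed
  have marg: "(\<Sum>I\<in>PiE A (\<lambda>_. B). \<Prod>c\<in>A. g i j c (I c)) = \<mu> a i * \<mu> b j" if "i \<in> B" "j \<in> B" for i j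
  proof -
    have "(\<Sum>y\<in>B. g i j a y) = (\<Sum>y\<in>B. if i = y then \<mu> a y else 0)"
      using \<open>a \<noteq> b\<close> by (intro sum.cong) (auto simp: g_def)
    then have ga: "(\<Sum>y\<in>B. g i j a y) = \<mu> a i" using that \<open>finite B\<close> by simp
    have "(\<Sum>y\<in>B. g i j b y) = (\<Sum>y\<in>B. if j = y then \<mu> b y else 0)"
      using \<open>a \<noteq> b\<close> by (intro sum.cong) (auto simp: g_def)
    then have gb: "(\<Sum>y\<in>B. g i j b y) = \<mu> b j" using that \<open>finite B\<close> by simp
    have gc: "(\<Sum>y\<in>B. g i j c y) = 1" if "c \<in> A - {a} - {b}" for c
      using that one by (auto simp: g_def)
    have "(\<Sum>I\<in>PiE A (\<lambda>_. B). \<Prod>c\<in>A. g i j c (I c)) = (\<Prod>c\<in>A. \<Sum>y\<in>B. g i j c y)"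
      using assms by (simp add: prod_sum_PiE)
    also have "\<dots> = (\<Sum>y\<in>B. g i j a y) * ((\<Sum>y\<in>B. g i j b y) * (\<Prod>c\<in>A - {a} - {b}. \<Sum>y\<in>B. g i j c y))"
      using assms by (simp add: prod.remove[of A a] prod.remove[of "A - {a}" b])
    also have "\<dots> = \<mu> a i * \<mu> b j" by (simp add: ga gb gc)
    finally show ?thesis .
  qed
  have "(\<Sum>I\<in>PiE A (\<lambda>_. B). (\<Prod>c\<in>A. \<mu> c (I c)) * F (I a) (I b))
      = (\<Sum>I\<in>PiE A (\<lambda>_. B). \<Sum>i\<in>B. \<Sum>j\<in>B. (\<Prod>c\<in>A. g i j c (I c)) * F i j)"
  proof (intro sum.cong refl)
    fix I assume "I \<in> PiE A (\<lambda>_. B)"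
    then have I: "I a \<in> B" "I b \<in> B" using assms(3,4) by auto
    have "(\<Sum>i\<in>B. \<Sum>j\<in>B. (\<Prod>c\<in>A. g i j c (I c)) * F i j)
        = (\<Sum>i\<in>B. if I a = i then (\<Sum>j\<in>B. if I b = j then (\<Prod>c\<in>A. \<mu> c (I c)) * F i j else 0) else 0)"
      unfolding g by (intro sum.cong) (auto intro: sum.cong)
    also have "\<dots> = (\<Prod>c\<in>A. \<mu> c (I c)) * F (I a) (I b)"
      using I \<open>finite B\<close> by simp
    finally show "(\<Prod>c\<in>A. \<mu> c (I c)) * F (I a) (I b) = (\<Sum>i\<in>B. \<Sum>j\<in>B. (\<Prod>c\<in>A. g i j c (I c)) * F i j)" ..
  qed
  also have "\<dots> = (\<Sum>i\<in>B. \<Sum>j\<in>B. \<Sum>I\<in>PiE A (\<lambda>_. B). (\<Prod>c\<in>A. g i j c (I c)) * F i j)"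
    by (subst sum.swap) (intro sum.cong refl sum.swap)
  also have "\<dots> = (\<Sum>i\<in>B. \<Sum>j\<in>B. \<mu> a i * \<mu> b j * F i j)"
    by (intro sum.cong refl) (simp add: marg flip: sum_distrib_right)
  finally show ?thesis .
qed

lemma sum_offdiagonal:
  fixes g :: "nat \<Rightarrow> nat \<Rightarrow> 'a::comm_monoid_add"
  shows "(\<Sum>i\<in>{0..N}. \<Sum>j\<in>{0..N} - {i}. g i j) = (\<Sum>a\<in>{0..N}. \<Sum>b\<in>{a<..N}. g a b + g b a)"
proof -
  have up: "(\<Sum>b\<in>{a<..N}. h b) = (\<Sum>b\<in>{0..N}. if a < b then h b else 0)" for a and h :: "nat \<Rightarrow> 'a"
    by (rule sum.mono_neutral_cong_left) auto
  have "(\<Sum>i\<in>{0..N}. \<Sum>j\<in>{0..N} - {i}. g i j)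
      = (\<Sum>i\<in>{0..N}. \<Sum>j\<in>{0..N}. (if i < j then g i j else 0) + (if j < i then g i j else 0))"
    by (intro sum.cong refl sum.mono_neutral_cong_left) auto
  also have "\<dots> = (\<Sum>i\<in>{0..N}. \<Sum>j\<in>{0..N}. if i < j then g i j else 0) +
      (\<Sum>i\<in>{0..N}. \<Sum>j\<in>{0..N}. if j < i then g i j else 0)"
    by (simp add: sum.distrib)
  also have "(\<Sum>i\<in>{0..N}. \<Sum>j\<in>{0..N}. if j < i then g i j else 0)
      = (\<Sum>i\<in>{0..N}. \<Sum>j\<in>{0..N}. if i < j then g j i else 0)"
    by (rule sum.swap)
  finally show ?thesis by (simp add: up sum.distrib)
qed

theorem theorem4p7:
  fixes k :: real and N :: nat and Qs :: "nat \<Rightarrow> obj"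
    and lam :: "obj \<Rightarrow> ept \<Rightarrow> nat \<Rightarrow> real" and z :: "nat \<Rightarrow> ept"
  assumes "2 \<le> k" and "1 \<le> N"
    and "weighting_system lam"
    and "\<forall>i\<in>{0..N}. valid_obj (Qs i)"
    and "\<forall>i\<in>{0..N}. z i \<in> hullQ (Qs i)"
  shows "(\<Sum>a\<in>{0..N}. \<Sum>b\<in>{a<..N}. Gk k (z a) (z b))
    \<ge> (\<Sum>I\<in>PiE {0..N} (\<lambda>_. {1..4::nat}).
          (\<Prod>a\<in>{0..N}. lam (Qs a) (z a) (I a)) * energyI k N Qs I)
      - (\<Sum>i\<in>{0..N}. \<Sum>j\<in>{0..N} - {i}. epsQ k (Qs i) (Qs j))"
proof -
  define P where "P I = (\<Prod>a\<in>{0..N}. lam (Qs a) (z a) (I a))" for I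
  have one: "(\<Sum>i\<in>{1..4}. lam (Qs c) (z c) i) = 1" if "c \<in> {0..N}" for c
    using weighting_systemD(2) assms(3-5) that by blast
  \<comment> \<open>Each pair energy depends on two entries of \<open>I\<close> only, so the weights
    of all other coordinates sum out.\<close>
  have "(\<Sum>I\<in>PiE {0..N} (\<lambda>_. {1..4}). P I * energyI k N Qs I)
      = (\<Sum>I\<in>PiE {0..N} (\<lambda>_. {1..4}). \<Sum>a\<in>{0..N}. \<Sum>b\<in>{a<..N}.
          P I * Gk k (verts (Qs a) (I a)) (verts (Qs b) (I b)))"
    by (simp add: energyI_def sum_distrib_left)
  also have "\<dots> = (\<Sum>a\<in>{0..N}. \<Sum>b\<in>{a<..N}. \<Sum>I\<in>PiE {0..N} (\<lambda>_. {1..4}).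
          P I * Gk k (verts (Qs a) (I a)) (verts (Qs b) (I b)))"
    by (subst sum.swap) (intro sum.cong refl sum.swap)
  also have "\<dots> = (\<Sum>a\<in>{0..N}. \<Sum>b\<in>{a<..N}. \<Sum>i=1..4. \<Sum>j=1..4.
          lam (Qs a) (z a) i * lam (Qs b) (z b) j * Gk k (verts (Qs a) i) (verts (Qs b) j))"
  proof (intro sum.cong refl)
    fix a b assume "a \<in> {0..N}" "b \<in> {a<..N}"
    then show "(\<Sum>I\<in>PiE {0..N} (\<lambda>_. {1..4}). P I * Gk k (verts (Qs a) (I a)) (verts (Qs b) (I b)))
      = (\<Sum>i=1..4. \<Sum>j=1..4. lam (Qs a) (z a) i * lam (Qs b) (z b) j * Gk k (verts (Qs a) i) (verts (Qs b) j))"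
      unfolding P_def using one
      by (intro sum_PiE_two_marginals[where F = "\<lambda>i j. Gk k (verts (Qs a) i) (verts (Qs b) j)"]) auto
  qed
  finally have expand: "(\<Sum>I\<in>PiE {0..N} (\<lambda>_. {1..4}). P I * energyI k N Qs I)
      = (\<Sum>a\<in>{0..N}. \<Sum>b\<in>{a<..N}. \<Sum>i=1..4. \<Sum>j=1..4.
          lam (Qs a) (z a) i * lam (Qs b) (z b) j * Gk k (verts (Qs a) i) (verts (Qs b) j))" .
  \<comment> \<open>The errors over ordered pairs are grouped by unordered pairs, each receiving the
    two terms of \<open>Gk_pair_replacement\<close>.\<close>
  have "(\<Sum>I\<in>PiE {0..N} (\<lambda>_. {1..4}). P I * energyI k N Qs I)
        - (\<Sum>i\<in>{0..N}. \<Sum>j\<in>{0..N} - {i}. epsQ k (Qs i) (Qs j))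
     = (\<Sum>a\<in>{0..N}. \<Sum>b\<in>{a<..N}. (\<Sum>i=1..4. \<Sum>j=1..4.
          lam (Qs a) (z a) i * lam (Qs b) (z b) j * Gk k (verts (Qs a) i) (verts (Qs b) j))
        - (epsQ k (Qs a) (Qs b) + epsQ k (Qs b) (Qs a)))"
    unfolding expand sum_offdiagonal sum_subtractf ..
  also have "\<dots> \<le> (\<Sum>a\<in>{0..N}. \<Sum>b\<in>{a<..N}. Gk k (z a) (z b))"
  proof (intro sum_mono)
    fix a b assume "a \<in> {0..N}" "b \<in> {a<..N}"
    then have "a \<in> {0..N}" "b \<in> {0..N}" by auto
    then show "(\<Sum>i=1..4. \<Sum>j=1..4.
          lam (Qs a) (z a) i * lam (Qs b) (z b) j * Gk k (verts (Qs a) i) (verts (Qs b) j))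
        - (epsQ k (Qs a) (Qs b) + epsQ k (Qs b) (Qs a)) \<le> Gk k (z a) (z b)"
      using assms(4,5) by (intro Gk_pair_replacement[OF assms(1,3)]) blast+
  qed
  finally show ?thesis unfolding P_def .
qed

end
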